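(* Let $L$ be a (right) Bol loop and suppose that at least one of the following ten conditions holds: (1) for all $x,y\in L$, either $xy=yx$ or $x^{-1}(xy)=y$; (2) for all $x,y\in L$, either $xy=yx$ or $(xy)x=x(yx)$; (3) for all $x,y\in L$, either $x^{-1}(xy)=y$ or $(xy)^{-1}=y^{-1}x^{-1}$; (4) for all $x,y\in L$, either $(xy)x=x(yx)$ or $(yx)^{-1}=x^{-1}y^{-1}$; (5) for all $x,y\in L$, either $x^{-1}(xy)=y$ or $y^{-1}(yx)=x$; (6) for all $x,y\in L$, either $(xy)x=x(yx)$ or $(xy)^{-1}=y^{-1}x^{-1}$; (7) for all $x,y\in L$, either $x^{-1}(xy)=y$ or $(yx)^{-1}=x^{-1}y^{-1}$; (8) for all $x,y\in L$, either $(xy)x=x(yx)$ or $y^{-1}(yx)=x$; (9) for all $x,y\in L$, either $(xy)x=x(yx)$ or $x^{-1}(xy)=y$; (10) for all $x,y\in L$, either $(xy)x=x(yx)$ or $(yx)y=y(xy)$. Then $L$ is a Moufang loop.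
   Context: A loop is a set with a binary operation (written as juxtaposition) having a two-sided identity $1$ and such that for all $a,b$ the equations $ax=b$ and $ya=b$ have unique solutions $x,y$. A loop is (right) Bol if $((xy)z)y=x((yz)y)$ for all $x,y,z$. A loop is Moufang if $((xy)z)y=x(y(zy))$ for all $x,y,z$. In a Bol loop every element $x$ has a two-sided inverse $x^{-1}$. In each condition, "either ... or" is inclusive, and which alternative holds may depend on the pair $(x,y)$. *)

theory Defs
  imports "HOL-Algebra.Group"
begin

(* A loop uses the HOL-Algebra record of carrier, product and identity, without the
   associativity of the locale monoid.  The record provides no division operations:
   they are expressed by unique solvability on the carrier. *)
locale loop =
  fixes L (structure)
  assumes m_closed: "\<lbrakk>x \<in> carrier L; y \<in> carrier L\<rbrakk> \<Longrightarrow> x \<otimes> y \<in> carrier L"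
    and one_closed: "\<one> \<in> carrier L"
    and l_one: "x \<in> carrier L \<Longrightarrow> \<one> \<otimes> x = x"
    and r_one: "x \<in> carrier L \<Longrightarrow> x \<otimes> \<one> = x"
    and l_div: "\<lbrakk>a \<in> carrier L; b \<in> carrier L\<rbrakk> \<Longrightarrow> \<exists>!x. x \<in> carrier L \<and> a \<otimes> x = b"
    and r_div: "\<lbrakk>a \<in> carrier L; b \<in> carrier L\<rbrakk> \<Longrightarrow> \<exists>!y. y \<in> carrier L \<and> y \<otimes> a = b"

locale bol_loop = loop +
  assumes bol: "\<lbrakk>x \<in> carrier L; y \<in> carrier L; z \<in> carrier L\<rbrakk>
    \<Longrightarrow> ((x \<otimes> y) \<otimes> z) \<otimes> y = x \<otimes> ((y \<otimes> z) \<otimes> y)"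

locale moufang_loop = loop +
  assumes moufang: "\<lbrakk>x \<in> carrier L; y \<in> carrier L; z \<in> carrier L\<rbrakk>
    \<Longrightarrow> ((x \<otimes> y) \<otimes> z) \<otimes> y = x \<otimes> (y \<otimes> (z \<otimes> y))"

(* The library inverse inv x is a definite description of a two-sided inverse;
   in a Bol loop it always denotes. *)
lemma (in bol_loop) two_sided_inverse_ex1:
  assumes y: "y \<in> carrier L"
  shows "\<exists>!z. z \<in> carrier L \<and> y \<otimes> z = \<one> \<and> z \<otimes> y = \<one>"
proof -
  obtain z where z: "z \<in> carrier L" "y \<otimes> z = \<one>"
    using l_div[OF y one_closed] by blast
  obtain x where x: "x \<in> carrier L" "x \<otimes> y = \<one>"
    using r_div[OF y one_closed] by blast
  have "((x \<otimes> y) \<otimes> z) \<otimes> y = x \<otimes> y"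
    using bol[OF x(1) y z(1)] z(2) l_one[OF y] by simp
  then have "z \<otimes> y = \<one>"
    using x(2) l_one[OF z(1)] by simp
  with z show ?thesis
    using l_div[OF y one_closed] by blast
qed

lemma (in bol_loop) inv_two_sided:
  assumes "y \<in> carrier L"
  shows "inv y \<in> carrier L" "y \<otimes> inv y = \<one>" "inv y \<otimes> y = \<one>"
  using theI'[OF two_sided_inverse_ex1[OF assms]] unfolding m_inv_def by auto

end

theory Submission
  imports Defs
begin

text \<open>
  Write \<open>assoc p x y\<close> for \<open>(p x) y = p (x y)\<close>.  In a Bol loop the set of these \<open>p\<close>, which are the fixed
  points of the inner map \<open>p \<mapsto> ((p x) y) (x y)\<^sup>-\<^sup>1\<close>, does not change when \<open>(x, y)\<close> is replaced by \<open>(y, x)\<close>,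
  \<open>(x, x y)\<close> or \<open>(x y, y\<^sup>-\<^sup>1)\<close>.  The alternatives in the ten conditions say that \<open>x\<^sup>-\<^sup>1\<close> (left inverse
  property), \<open>x\<close> (flexibility) or \<open>(x y)\<^sup>-\<^sup>1\<close> (antiautomorphic inverse property) is a fixed point.  Evaluating
  conditions (2), (4), (6) at \<open>(x\<^sup>-\<^sup>1, (x y) x)\<close> yields (1), (3), (7); the symmetries then settle (1), (3)
  and (5), and lead from (7) to (8) and from (8) to (9).

  In case (9) suppose \<open>x\<^sup>-\<^sup>1 (x y) \<noteq> y\<close> and put \<open>d = y (x y)\<^sup>-\<^sup>1\<close> and \<open>c = (x\<^sup>-\<^sup>1 y\<^sup>-\<^sup>1) (x y)\<close>.  The left inverse
  property fails at \<open>(d, y)\<close> and \<open>(d, c)\<close> too, so \<open>(x, y)\<close>, \<open>(d, y)\<close> and \<open>(d, c)\<close> are flexible pairs, and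
  these three facts force \<open>d = x\<^sup>-\<^sup>1\<close>, that is \<open>x\<^sup>-\<^sup>1 (x y) = y\<close>.  Condition (10) implies (9) by a long
  equational derivation.
\<close>

context bol_loop
begin

section \<open>Total operations on the carrier\<close>

text \<open>
  With every argument retracted to the carrier, \<open>mul\<close> and \<open>nv\<close> satisfy their identities without membership
  premises; an element that stands alone on one side of an identity must then be wrapped in \<open>ret\<close>.
\<close>

definition ret :: "'a \<Rightarrow> 'a" where
  "ret x = (if x \<in> carrier L then x else \<one>)"

definition mul :: "'a \<Rightarrow> 'a \<Rightarrow> 'a"  (infixl "\<bullet>" 70) where
  "x \<bullet> y = ret x \<otimes> ret y"

definition nv :: "'a \<Rightarrow> 'a" where
  "nv x = inv (ret x)"

lemma ret_closed [simp]: "ret x \<in> carrier L"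
  by (simp add: ret_def one_closed)

lemma ret_id [simp]: "x \<in> carrier L \<Longrightarrow> ret x = x"
  by (simp add: ret_def)

lemma mul_closed [simp]: "x \<bullet> y \<in> carrier L"
  by (simp add: mul_def m_closed)

lemma nv_closed [simp]: "nv x \<in> carrier L"
  by (simp add: nv_def inv_two_sided)

lemma mul_ret [simp]: "ret x \<bullet> y = x \<bullet> y" "x \<bullet> ret y = x \<bullet> y" "nv (ret x) = nv x"
  by (simp_all add: mul_def nv_def)

lemma one_mul [simp]: "\<one> \<bullet> x = ret x" "x \<bullet> \<one> = ret x"
  by (simp_all add: mul_def l_one r_one one_closed)

lemma mul_nv [simp]: "x \<bullet> nv x = \<one>" "nv x \<bullet> x = \<one>"
  using inv_two_sided[of "ret x"] by (simp_all add: mul_def nv_def)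

lemma bol_mul: "((x \<bullet> y) \<bullet> z) \<bullet> y = x \<bullet> ((y \<bullet> z) \<bullet> y)"
  using bol[of "ret x" "ret y" "ret z"] by (simp add: mul_def m_closed)

lemma mul_left_cancel: "x \<bullet> y = x \<bullet> z \<longleftrightarrow> ret y = ret z"
proof
  assume "x \<bullet> y = x \<bullet> z"
  then have sols: "ret y \<in> carrier L \<and> ret x \<otimes> ret y = x \<bullet> y" "ret z \<in> carrier L \<and> ret x \<otimes> ret z = x \<bullet> y"
    by (simp_all, simp_all add: mul_def)
  have ex: "\<exists>!u. u \<in> carrier L \<and> ret x \<otimes> u = x \<bullet> y"
    by (rule l_div) simp_all
  show "ret y = ret z"
    using the1_equality[OF ex sols(1)] the1_equality[OF ex sols(2)] by simp
qed (simp add: mul_def)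

lemma mul_right_cancel: "y \<bullet> x = z \<bullet> x \<longleftrightarrow> ret y = ret z"
proof
  assume "y \<bullet> x = z \<bullet> x"
  then have sols: "ret y \<in> carrier L \<and> ret y \<otimes> ret x = y \<bullet> x" "ret z \<in> carrier L \<and> ret z \<otimes> ret x = y \<bullet> x"
    by (simp_all, simp_all add: mul_def)
  have ex: "\<exists>!u. u \<in> carrier L \<and> u \<otimes> ret x = y \<bullet> x"
    by (rule r_div) simp_all
  show "ret y = ret z"
    using the1_equality[OF ex sols(1)] the1_equality[OF ex sols(2)] by simp
qed (simp add: mul_def)

section \<open>Inverses and the right inverse property\<close>

lemma nv_nv [simp]: "nv (nv x) = ret x"
  using mul_left_cancel[of "nv x" "nv (nv x)" x] by simp

text \<open>The Bol identity with \<open>z = nv y\<close> gives \<open>((x y) nv y) y = x y\<close>,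
  and \<open>y\<close> cancels.\<close>

lemma rip [simp]: "(x \<bullet> y) \<bullet> nv y = ret x"
proof -
  have "((x \<bullet> y) \<bullet> nv y) \<bullet> y = x \<bullet> y"
    by (simp add: bol_mul)
  then show ?thesis
    by (simp add: mul_right_cancel)
qed

lemma rip' [simp]: "(x \<bullet> nv y) \<bullet> y = ret x"
  using rip[of x "nv y"] by simp

text \<open>The Bol identity with first factor \<open>nv x\<close> strips \<open>x\<close> from the
  block \<open>(x z) x\<close>, although \<open>nv x\<close> need not cancel \<open>x\<close> in
  general.\<close>

lemma nv_mul_triple: "nv x \<bullet> ((x \<bullet> z) \<bullet> x) = z \<bullet> x"
  using bol_mul[of "nv x" x z] by simp

lemma right_alt: "(x \<bullet> y) \<bullet> y = x \<bullet> (y \<bullet> y)"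
  using bol_mul[of x y \<one>] by simp

text \<open>By the Bol identity, multiplying \<open>(x y) x\<close> by
  \<open>(nv x nv y) nv x\<close> means multiplying by \<open>nv x\<close>, \<open>nv y\<close>,
  \<open>nv x\<close> in turn, and the right inverse property removes one factor each time.\<close>

lemma nv_triple: "nv ((x \<bullet> y) \<bullet> x) = (nv x \<bullet> nv y) \<bullet> nv x"
proof -
  have "((x \<bullet> y) \<bullet> x) \<bullet> ((nv x \<bullet> nv y) \<bullet> nv x) = \<one>"
    using bol_mul[of "(x \<bullet> y) \<bullet> x" "nv x" "nv y"] by simp
  then show ?thesis
    using mul_left_cancel[of "(x \<bullet> y) \<bullet> x" "nv ((x \<bullet> y) \<bullet> x)" "(nv x \<bullet> nv y) \<bullet> nv x"] by simp
qed

section \<open>Associating triples and their symmetries\<close>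

definition assoc :: "'a \<Rightarrow> 'a \<Rightarrow> 'a \<Rightarrow> bool" where
  "assoc p x y \<longleftrightarrow> (p \<bullet> x) \<bullet> y = p \<bullet> (x \<bullet> y)"

lemma assoc_ret [simp]: "assoc (ret p) x y = assoc p x y" "assoc p (ret x) y = assoc p x y" "assoc p x (ret y) = assoc p x y"
  by (simp_all add: assoc_def)

text \<open>Since \<open>p ((x y) x) = ((p x) y) x\<close>, the equation for \<open>(x y, x)\<close>
  is the one for \<open>(x, y)\<close> multiplied on the right by \<open>x\<close>.\<close>

lemma assoc_mul1: "assoc p (x \<bullet> y) x \<longleftrightarrow> assoc p x y"
  using mul_right_cancel[of "p \<bullet> (x \<bullet> y)" x "(p \<bullet> x) \<bullet> y"]
  by (auto simp: assoc_def bol_mul)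

text \<open>Here the equation for \<open>(x, y)\<close> is multiplied on the right by
  \<open>nv y\<close>: both \<open>p ((x y) nv y)\<close> and \<open>((p x) y) nv y\<close> are
  \<open>p x\<close>.\<close>

lemma assoc_mul2: "assoc p (x \<bullet> y) (nv y) \<longleftrightarrow> assoc p x y"
  using mul_right_cancel[of "p \<bullet> (x \<bullet> y)" "nv y" "(p \<bullet> x) \<bullet> y"]
  by (auto simp: assoc_def)

lemma assoc_mul: "assoc p x (x \<bullet> y) \<longleftrightarrow> assoc p x y"
  using assoc_mul1[of p "x \<bullet> y" "nv y"] assoc_mul2[of p x y] by simp

lemma ex_left_quot: "\<exists>z. x \<bullet> z = ret y"
proof -
  obtain z where "z \<in> carrier L" "ret x \<otimes> z = ret y"
    using l_div[of "ret x" "ret y"] by auto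
  then show ?thesis
    by (intro exI[of _ z]) (simp add: mul_def)
qed

text \<open>With \<open>y = x z\<close>, both sides reduce to \<open>assoc p x z\<close>.\<close>

lemma assoc_swap: "assoc p x y \<longleftrightarrow> assoc p y x"
proof -
  obtain z where "x \<bullet> z = ret y"
    using ex_left_quot by blast
  then show ?thesis
    using assoc_mul[of p x z] assoc_mul1[of p x z] by simp
qed

lemma ret_simps [simp]: "ret (x \<bullet> y) = x \<bullet> y" "ret (nv x) = nv x" "ret (ret x) = ret x" "ret \<one> = \<one>"
  by (simp_all add: one_closed)

lemma nv_eq_iff: "nv x = nv y \<longleftrightarrow> ret x = ret y"
  by (metis mul_ret(3) nv_nv)

section \<open>Inverse properties and flexibility of a pair\<close>

lemma lip_iff: "assoc (nv x) x y \<longleftrightarrow> nv x \<bullet> (x \<bullet> y) = ret y"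
  by (auto simp: assoc_def)

text \<open>Unfolded, \<open>assoc x x y\<close> is left alternativity
  \<open>(x x) y = x (x y)\<close>; the swap symmetry makes it equivalent to flexibility.\<close>

lemma flex_iff: "assoc x x y \<longleftrightarrow> (x \<bullet> y) \<bullet> x = x \<bullet> (y \<bullet> x)"
  using assoc_swap[of x x y] by (simp add: assoc_def)

lemma aaip_iff: "assoc (nv (x \<bullet> y)) x y \<longleftrightarrow> nv (x \<bullet> y) = nv y \<bullet> nv x"
proof -
  have "assoc (nv (x \<bullet> y)) x y \<longleftrightarrow> (nv (x \<bullet> y) \<bullet> x) \<bullet> y = nv y \<bullet> y"
    by (simp add: assoc_def)
  also have "\<dots> \<longleftrightarrow> nv (x \<bullet> y) \<bullet> x = (nv y \<bullet> nv x) \<bullet> x"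
    using mul_right_cancel[of "nv (x \<bullet> y) \<bullet> x" y "nv y"] by simp
  finally show ?thesis
    by (simp only: mul_right_cancel ret_simps)
qed

text \<open>If \<open>nv x (x y) = y\<close>, then \<open>y nv (x y) = nv x\<close>, and the Bol
  identity for \<open>x\<close>, \<open>y\<close>, \<open>nv (x y)\<close> becomes
  \<open>y = x (nv x y)\<close>.\<close>

lemma lip_nv: "assoc (nv x) x y \<longleftrightarrow> assoc x (nv x) y"
proof -
  have "assoc x (nv x) y" if "assoc (nv x) x y" for x
  proof -
    have "nv x \<bullet> (x \<bullet> y) = ret y"
      using that by (simp add: lip_iff)
    then have "y \<bullet> nv (x \<bullet> y) = nv x"
      using rip[of "nv x" "x \<bullet> y"] by simp
    then show ?thesis
      using bol_mul[of x y "nv (x \<bullet> y)"] by (simp add: assoc_def)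
  qed
  from this[of x] this[of "nv x"] show ?thesis
    by auto
qed

lemma lip_mul: "assoc (nv x) x (x \<bullet> y) \<longleftrightarrow> assoc (nv x) x y"
  by (rule assoc_mul)

lemma aaip_lip: "assoc (nv (x \<bullet> y)) x y \<longleftrightarrow> assoc (nv (x \<bullet> y)) (x \<bullet> y) x"
  by (rule assoc_mul1[symmetric])

text \<open>Inverting both sides of \<open>nv (x y) = nv y nv x\<close> gives the same property at
  \<open>(nv y, nv x)\<close>.\<close>

lemma aaip_nv: "assoc (nv (x \<bullet> y)) x y \<longleftrightarrow> assoc (nv (nv y \<bullet> nv x)) (nv y) (nv x)"
  using nv_eq_iff[of "nv (x \<bullet> y)" "nv y \<bullet> nv x"] by (simp add: aaip_iff) metis

text \<open>With \<open>w\<close> the solution of \<open>nv x w = y\<close>, each of the three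
  properties equates two of the elements \<open>nv w\<close>, \<open>nv (x y)\<close>,
  \<open>nv y nv x\<close>. Hence any two of them imply the third.\<close>

lemma lip_lip_aaip:
  shows "assoc (nv x) x y \<Longrightarrow> assoc (nv y) y (nv x) \<longleftrightarrow> assoc (nv (x \<bullet> y)) x y"
    and "assoc (nv y) y (nv x) \<Longrightarrow> assoc (nv (x \<bullet> y)) x y \<Longrightarrow> assoc (nv x) x y"
proof -
  obtain w where w: "nv x \<bullet> w = ret y"
    using ex_left_quot by blast
  then have w': "y \<bullet> nv w = nv x"
    using rip[of "nv x" w] by simp
  have 1: "assoc (nv x) x y \<longleftrightarrow> nv w = nv (x \<bullet> y)"
    using mul_left_cancel[of "nv x" "x \<bullet> y" w] w by (auto simp: lip_iff nv_eq_iff)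
  have "assoc (nv y) y (nv x) \<longleftrightarrow> y \<bullet> (nv y \<bullet> nv x) = nv x"
    unfolding lip_nv[of y] by (auto simp: assoc_def)
  then have 2: "assoc (nv y) y (nv x) \<longleftrightarrow> nv w = nv y \<bullet> nv x"
    using mul_left_cancel[of y "nv y \<bullet> nv x" "nv w"] w' by auto
  show "assoc (nv x) x y \<Longrightarrow> assoc (nv y) y (nv x) \<longleftrightarrow> assoc (nv (x \<bullet> y)) x y"
    and "assoc (nv y) y (nv x) \<Longrightarrow> assoc (nv (x \<bullet> y)) x y \<Longrightarrow> assoc (nv x) x y"
    unfolding 1 2 aaip_iff by auto
qed

section \<open>Autotopisms attached to the inner maps\<close>

text \<open>This is the action on products of the composed autotopisms for \<open>x\<close>,
  \<open>y\<close> and \<open>nv (x y)\<close>, each of which multiplies a product on the right by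
  the inverse of its parameter.\<close>

definition companion :: "'a \<Rightarrow> 'a \<Rightarrow> 'a \<Rightarrow> 'a" where
  "companion x y p = ((p \<bullet> nv x) \<bullet> nv y) \<bullet> (x \<bullet> y)"

text \<open>The Bol identity read as an autotopism: right translation by \<open>x\<close> on the
  first factor, \<open>v\<close> to \<open>(nv x v) nv x\<close> on the second, right translation by
  \<open>nv x\<close> on the product.\<close>

lemma mul_nv_autotopism: "(u \<bullet> v) \<bullet> nv x = (u \<bullet> x) \<bullet> ((nv x \<bullet> v) \<bullet> nv x)"
  using bol_mul[of "u \<bullet> x" "nv x" v] by simp

text \<open>With \<open>\<gamma>\<close> the inner map of the pair \<open>(x, y)\<close>, the triple \<open>(\<gamma>, companion x y, companion x y)\<close> is an autotopism.\<close>

lemma companion_mul: "companion x y (u \<bullet> v) = (((u \<bullet> x) \<bullet> y) \<bullet> nv (x \<bullet> y)) \<bullet> companion x y v"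
proof -
  \<comment> \<open>\<open>w\<close> is the image of \<open>v\<close> under the second components of
    the three autotopisms. At \<open>u = \<one>\<close> the first component gives
    \<open>\<one>\<close>, so \<open>w\<close> is \<open>companion x y v\<close>.\<close>
  define w where "w = ((x \<bullet> y) \<bullet> ((nv y \<bullet> ((nv x \<bullet> v) \<bullet> nv x)) \<bullet> nv y)) \<bullet> (x \<bullet> y)"
  have *: "companion x y (u \<bullet> v) = (((u \<bullet> x) \<bullet> y) \<bullet> nv (x \<bullet> y)) \<bullet> w" for u
    using mul_nv_autotopism[of "(u \<bullet> x) \<bullet> y" "(nv y \<bullet> ((nv x \<bullet> v) \<bullet> nv x)) \<bullet> nv y" "nv (x \<bullet> y)"]
    by (simp add: companion_def w_def mul_nv_autotopism[of u v x] mul_nv_autotopism[of "u \<bullet> x" _ y])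
  have "companion x y v = w"
    using *[of \<one>] by (simp add: companion_def w_def)
  with * show ?thesis
    by simp
qed

lemma companion_mul_assoc: "assoc u x y \<Longrightarrow> companion x y (u \<bullet> v) = u \<bullet> companion x y v"
  by (simp add: companion_mul assoc_def)

section \<open>Every pair flexible or with the left inverse property\<close>

lemma mul_quot: "a \<bullet> ((b \<bullet> nv (a \<bullet> b)) \<bullet> b) = ret b"
  using bol_mul[of a b "nv (a \<bullet> b)"] by simp

lemma quot_ne_nv: "\<not> assoc (nv a) a b \<Longrightarrow> b \<bullet> nv (a \<bullet> b) \<noteq> nv a"
  by (metis lip_iff rip')

text \<open>Otherwise \<open>nv d (d p) = p = a (d p)\<close>, so \<open>nv d = a\<close>, against
  \<open>quot_ne_nv\<close>.\<close>

lemma not_lip_quot: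
  assumes "\<not> assoc (nv a) a b" and d: "d = b \<bullet> nv (a \<bullet> b)" and p: "a \<bullet> (d \<bullet> p) = ret p"
  shows "\<not> assoc (nv d) d p"
proof
  assume "assoc (nv d) d p"
  then have "nv d \<bullet> (d \<bullet> p) = a \<bullet> (d \<bullet> p)"
    using p by (simp add: lip_iff)
  then have "nv d = ret a"
    by (simp add: mul_right_cancel)
  then have "d = nv a"
    using nv_nv[of d] d by simp
  with assms(1) d show False
    using quot_ne_nv by blast
qed

lemma lip_if_flex_or_lip:
  assumes hyp: "\<And>x y. assoc x x y \<or> assoc (nv x) x y"
  shows "assoc (nv a) a b"
proof (rule ccontr)
  assume nlip: "\<not> assoc (nv a) a b"
  \<comment> \<open>\<open>c\<close> is the companion of \<open>\<one>\<close>, \<open>d\<close> is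
    the image of \<open>nv a\<close> under the inner map of \<open>(a, b)\<close>, and
    \<open>s\<close> below solves \<open>a s = b\<close>.\<close>
  define c where "c = (nv a \<bullet> nv b) \<bullet> (a \<bullet> b)"
  define d where "d = b \<bullet> nv (a \<bullet> b)"
  define s where "s = d \<bullet> b"
  have [simp]: "ret c = c" "ret d = d" "ret s = s"
    by (simp_all add: c_def d_def s_def)
  have as: "a \<bullet> s = ret b"
    using mul_quot[of a b] by (simp add: d_def s_def)
  have d_ne: "d \<noteq> nv a"
    using quot_ne_nv[OF nlip] by (simp add: d_def)
  have fab: "assoc a a b"
    using hyp nlip by blast
  have c1: "companion a b (p \<bullet> \<one>) = (((p \<bullet> a) \<bullet> b) \<bullet> nv (a \<bullet> b)) \<bullet> c" for p
    using companion_mul[of a b p \<one>] by (simp add: companion_def c_def)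
  have comp_a: "companion a b a = a \<bullet> c" and comp_nv: "companion a b (nv a) = d \<bullet> c"
    using c1[of a] c1[of "nv a"] fab by (simp_all add: companion_def assoc_def d_def)
  \<comment> \<open>The companion of \<open>\<one>\<close> is computed from \<open>nv a a\<close>
    here and from \<open>a nv a\<close> in \<open>adc\<close>; the inner map fixes \<open>a\<close>
    because \<open>(a, b)\<close> is flexible.\<close>
  have dac: "d \<bullet> (a \<bullet> c) = c"
    using companion_mul[of a b "nv a" a] comp_a by (simp add: companion_def c_def d_def)
  have adc: "a \<bullet> (d \<bullet> c) = c"
    using companion_mul_assoc[OF fab, of "nv a"] comp_nv by (simp add: companion_def c_def)
  \<comment> \<open>\<open>as\<close> and \<open>adc\<close> have the form
    \<open>a (d p) = p\<close> for \<open>p = b\<close> and \<open>p = c\<close>, so the left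
    inverse property fails at \<open>(d, b)\<close> and \<open>(d, c)\<close>.\<close>
  have fdb: "assoc d d b" and fdc: "assoc d d c"
    using hyp not_lip_quot[OF nlip d_def, of b] not_lip_quot[OF nlip d_def, of c] as adc by (auto simp: s_def)
  have daac: "d \<bullet> (a \<bullet> (a \<bullet> c)) = a \<bullet> c"
    using bol_mul[of d "a \<bullet> c" "nv c"] dac by simp
  \<comment> \<open>As \<open>d (a c) = c\<close> and \<open>d (a (a c)) = a c\<close>, the symmetry
    from \<open>(d, y)\<close> to \<open>(d, d y)\<close> carries flexibility back from
    \<open>c\<close> to \<open>a c\<close> and then to \<open>a (a c)\<close>.\<close>
  have "assoc d d (a \<bullet> c)"
    using fdc assoc_mul[of d d "a \<bullet> c"] dac by simp
  then have "assoc d d (a \<bullet> (a \<bullet> c))"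
    using assoc_mul[of d d "a \<bullet> (a \<bullet> c)"] daac by simp
  then have ddaac: "(d \<bullet> d) \<bullet> (a \<bullet> (a \<bullet> c)) = c"
    using daac dac by (simp add: assoc_def)
  have a_eq: "ret a = b \<bullet> nv s"
    using rip[of a s] as by simp
  then have ab: "a \<bullet> b = (b \<bullet> nv s) \<bullet> b"
    by (metis mul_ret(1))
  have twist: "(p \<bullet> nv s) \<bullet> b = (p \<bullet> nv b) \<bullet> (a \<bullet> b)" for p
    using bol_mul[of "p \<bullet> nv b" b "nv s"] by (simp add: ab)
  have "(d \<bullet> d) \<bullet> b = d \<bullet> s"
    using fdb by (simp add: assoc_def s_def)
  then have "((d \<bullet> d) \<bullet> b) \<bullet> (nv s \<bullet> nv s) = d \<bullet> nv s"
    by (simp flip: right_alt)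
  moreover have "b \<bullet> (nv s \<bullet> nv s) = a \<bullet> nv s"
    using mul_ret(1)[of a "nv s"] by (simp add: a_eq right_alt[symmetric] del: mul_ret)
  \<comment> \<open>The aim is to evaluate \<open>(d nv s) b\<close> twice: \<open>twist\<close>
    gives \<open>(d nv b) (a b)\<close>, while the Bol identity leads through \<open>ddaac\<close>
    to \<open>c = (nv a nv b) (a b)\<close>. Right cancellation then yields
    \<open>d = nv a\<close>.\<close>
  ultimately have "(d \<bullet> nv s) \<bullet> b = (d \<bullet> d) \<bullet> ((a \<bullet> nv s) \<bullet> b)"
    using bol_mul[of "d \<bullet> d" b "nv s \<bullet> nv s"] by simp
  also have "(a \<bullet> nv s) \<bullet> b = companion a b (a \<bullet> a)"
    by (simp add: twist companion_def)
  also have "\<dots> = a \<bullet> (a \<bullet> c)"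
    using companion_mul_assoc[OF fab] comp_a by simp
  finally have "(d \<bullet> nv b) \<bullet> (a \<bullet> b) = (nv a \<bullet> nv b) \<bullet> (a \<bullet> b)"
    by (simp add: twist ddaac) (simp add: c_def)
  then have "d = nv a"
    by (simp add: mul_right_cancel)
  with d_ne show False ..
qed

section \<open>Reductions between the other conditions\<close>

text \<open>Since \<open>nv x ((x y) x) = y x\<close>, applying left multiplication by
  \<open>nv x\<close> to the flexible law at \<open>(x, y)\<close> gives the left inverse property
  at \<open>(x, y x)\<close>.\<close>

lemma flex_lip: "assoc x x y \<longleftrightarrow> assoc (nv x) x (y \<bullet> x)"
  using mul_left_cancel[of "nv x" "x \<bullet> (y \<bullet> x)" "(x \<bullet> y) \<bullet> x"]
  by (auto simp: flex_iff lip_iff nv_mul_triple)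

text \<open>With \<open>t = (x y) x\<close>, one has \<open>(nv x t) nv x = y\<close> and
  \<open>nv x (t nv x) = nv x (x y)\<close>.\<close>

lemma flex_nv: "assoc (nv x) (nv x) ((x \<bullet> y) \<bullet> x) \<longleftrightarrow> assoc (nv x) x y"
  by (auto simp: flex_iff lip_iff nv_mul_triple)

lemma assoc_nv_mul: "assoc p (nv x) (y \<bullet> x) \<longleftrightarrow> assoc p x y"
  using assoc_swap[of p "nv x" "y \<bullet> x"] assoc_swap[of p x y] by (simp add: assoc_mul2)

text \<open>If the left inverse property fails at \<open>(x, y)\<close>, it fails at
  \<open>(nv x, x y)\<close>, so both pairs commute and
  \<open>nv x (x y) = (y x) nv x = y\<close>.\<close>

lemma lip_if_comm_or_lip:
  assumes hyp: "\<And>x y. x \<bullet> y = y \<bullet> x \<or> assoc (nv x) x y"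
  shows "assoc (nv x) x y"
proof (rule ccontr)
  assume nlip: "\<not> assoc (nv x) x y"
  then have "\<not> assoc (nv (nv x)) (nv x) (x \<bullet> y)"
    using lip_nv[of x "x \<bullet> y"] by (simp add: lip_mul)
  then have "nv x \<bullet> (x \<bullet> y) = (x \<bullet> y) \<bullet> nv x"
    using hyp by blast
  also have "\<dots> = (y \<bullet> x) \<bullet> nv x"
    using hyp[of x y] nlip by simp
  finally show False
    using nlip by (simp add: lip_iff)
qed

text \<open>Failure of the antiautomorphic inverse property at \<open>(x, y)\<close> forces the left
  inverse property at \<open>(x, y)\<close> and \<open>(y, nv x)\<close>, which contradicts the
  failure. At \<open>(x y, nv y)\<close> the antiautomorphic property is the left inverse property
  at \<open>(x, y)\<close>.\<close>

lemma lip_if_lip_or_aaip: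
  assumes hyp: "\<And>x y. assoc (nv x) x y \<or> assoc (nv (x \<bullet> y)) x y"
  shows "assoc (nv x) x y"
proof -
  have aaip: "assoc (nv (x \<bullet> y)) x y" for x y
  proof (rule ccontr)
    assume *: "\<not> assoc (nv (x \<bullet> y)) x y"
    then have "assoc (nv (nv y)) (nv y) (nv x)"
      using hyp aaip_nv by blast
    then have "assoc (nv y) y (nv x)"
      using lip_nv by simp
    with * show False
      using hyp lip_lip_aaip(1) by blast
  qed
  from this[of "x \<bullet> y" "nv y"] show ?thesis
    by (simp add: assoc_mul2)
qed

text \<open>A failure at \<open>(x, y)\<close> spreads to \<open>(x, x y)\<close> and
  \<open>(nv x, y)\<close>. The swapped pairs then supply the two properties that force the left
  inverse property at \<open>(x, y)\<close>.\<close>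

lemma lip_if_lip_or_lip_swapped:
  assumes hyp: "\<And>x y. assoc (nv x) x y \<or> assoc (nv y) y x"
  shows "assoc (nv x) x y"
proof (rule ccontr)
  assume nlip: "\<not> assoc (nv x) x y"
  then have "assoc (nv (x \<bullet> y)) x y"
    using hyp[of x "x \<bullet> y"] by (simp add: lip_mul aaip_lip)
  moreover have "assoc (nv y) y (nv x)"
    using nlip hyp[of "nv x" y] lip_nv[of x y] by simp
  ultimately show False
    using nlip lip_lip_aaip(2) by blast
qed

lemma lip_if_flex_or_lip_swapped:
  assumes hyp: "\<And>x y. assoc x x y \<or> assoc (nv y) y x"
  shows "assoc (nv x) x y"
proof (rule lip_if_flex_or_lip)
  \<comment> \<open>Evaluation at \<open>(nv x, y x)\<close> turns flexibility into the left inverse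
    property at \<open>(x, y)\<close>, and the other alternative into the antiautomorphic property
    at \<open>(y, x)\<close>.\<close>
  have aaip: "assoc (nv x) x y \<or> assoc (nv (y \<bullet> x)) y x" for x y
    using hyp[of "nv x" "y \<bullet> x"] by (simp add: assoc_nv_mul assoc_mul2)
  fix x y
  show "assoc x x y \<or> assoc (nv x) x y"
  proof (rule ccontr)
    assume *: "\<not> (assoc x x y \<or> assoc (nv x) x y)"
    then have lyx: "assoc (nv y) y x"
      using hyp by blast
    have "assoc (nv (y \<bullet> x)) y x" and ayx': "assoc (nv (y \<bullet> nv x)) y (nv x)"
      using * aaip[of x y] aaip[of "nv x" y] lip_nv[of x y] by simp_all
    then have "assoc (nv x) x (nv y)"
      using lyx lip_lip_aaip(1) by blast
    then have "assoc (nv (nv x)) (nv x) (nv y)"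
      using lip_nv[of x "nv y"] by simp
    then have "assoc (nv y) y (nv x)"
      using ayx' lip_lip_aaip(2) by blast
    then have "\<not> assoc (nv (x \<bullet> y)) (x \<bullet> y) x"
      using * lip_lip_aaip(2) by (auto simp: aaip_lip)
    then show False
      using * hyp[of x "x \<bullet> y"] by (simp add: assoc_mul)
  qed
qed

section \<open>Every pair flexible in one of the two orders\<close>

text \<open>The two bracketed elements are the solutions of \<open>x p = y\<close> and
  \<open>y q = x\<close>; the first equation gives \<open>y nv p = x\<close>, so
  \<open>q = nv p\<close>.\<close>

lemma nv_left_quot: "nv ((nv x \<bullet> (y \<bullet> x)) \<bullet> nv x) = (nv y \<bullet> (x \<bullet> y)) \<bullet> nv y"
proof -
  let ?p = "(nv x \<bullet> (y \<bullet> x)) \<bullet> nv x" and ?q = "(nv y \<bullet> (x \<bullet> y)) \<bullet> nv y"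
  have "x \<bullet> ?p = ret y" "y \<bullet> ?q = ret x"
    using bol_mul[of x "nv x" "y \<bullet> x"] bol_mul[of y "nv y" "x \<bullet> y"] by simp_all
  then have "y \<bullet> nv ?p = y \<bullet> ?q"
    using rip[of x ?p] by simp
  then show ?thesis
    by (simp only: mul_left_cancel ret_simps)
qed

text \<open>For a counterexample \<open>(a, b)\<close>, the hypothesis makes several related pairs
  flexible, and the inner map of \<open>(a, b)\<close> fixes \<open>b\<close> and
  \<open>a b\<close>. The resulting equations force \<open>d = nv a\<close>.\<close>

lemma flex_or_lip_if_flex_or_flex_swapped:
  assumes hyp: "\<And>x y. (x \<bullet> y) \<bullet> x = x \<bullet> (y \<bullet> x) \<or> (y \<bullet> x) \<bullet> y = y \<bullet> (x \<bullet> y)"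
    and ab: "ret a = a" "ret b = b"
  shows "assoc a a b \<or> assoc (nv a) a b"
proof (rule ccontr)
  assume "\<not> (assoc a a b \<or> assoc (nv a) a b)"
  then have nflex: "\<not> assoc a a b" and nlip: "\<not> assoc (nv a) a b"
    by auto
  \<comment> \<open>\<open>w\<close> and \<open>d\<close> are the images of \<open>a\<close> and \<open>nv a\<close> under the inner map of the pair \<open>(a, b)\<close>.\<close>
  define c where h4: "c = (nv a \<bullet> nv b) \<bullet> (a \<bullet> b)"
  define d where h7: "d = b \<bullet> nv (a \<bullet> b)"
  define w where h3: "w = ((a \<bullet> a) \<bullet> b) \<bullet> nv (a \<bullet> b)"
  have cdw: "ret c = c" "ret d = d" "ret w = w"
    by (simp_all only: h4 h7 h3 ret_simps)
  note rets = mul_ret ret_simps ab cdw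
  have hyp': "assoc x x y \<or> assoc y y x" for x y
    using hyp by (simp add: flex_iff)
  have h5: "d \<bullet> (a \<bullet> b) = b" and h2: "a \<bullet> (d \<bullet> b) = b"
    using mul_quot[of a b] ab by (simp_all add: h7)
  have h12: "d \<noteq> nv a"
    using quot_ne_nv[OF nlip] by (simp add: h7)
  have nlipd: "\<not> assoc (nv d) d b"
    using not_lip_quot[OF nlip h7] h2 ab by simp
  then have h14: "nv d \<bullet> (d \<bullet> b) \<noteq> b"
    using ab by (simp add: lip_iff)
  have fba: "assoc b b a" and faba: "assoc (a \<bullet> b) (a \<bullet> b) a"
    using hyp'[of a b] hyp'[of a "a \<bullet> b"] nflex by (auto simp: assoc_mul)
  then have bab: "assoc b a b" and abab: "assoc (a \<bullet> b) a b"
    using assoc_swap[of b b a] by (simp_all add: assoc_mul1)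
  have h1: "(b \<bullet> a) \<bullet> b = b \<bullet> (a \<bullet> b)"
    using fba by (simp add: flex_iff)
  \<comment> \<open>Failure at \<open>(z, b)\<close> means that \<open>(nv z, b z)\<close> is not
    flexible, so \<open>(b z, nv z)\<close> is.\<close>
  have twist: "((b \<bullet> z) \<bullet> nv z) \<bullet> (b \<bullet> z) = (b \<bullet> z) \<bullet> (nv z \<bullet> (b \<bullet> z))" if "\<not> assoc (nv z) z b" for z
    using that hyp'[of "nv z" "b \<bullet> z"] by (simp add: assoc_nv_mul flex_iff[of "b \<bullet> z"])
  have h6: "((b \<bullet> a) \<bullet> nv a) \<bullet> (b \<bullet> a) = (b \<bullet> a) \<bullet> (nv a \<bullet> (b \<bullet> a))"
    and h13: "((b \<bullet> d) \<bullet> nv d) \<bullet> (b \<bullet> d) = (b \<bullet> d) \<bullet> (nv d \<bullet> (b \<bullet> d))"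
    using twist nlip nlipd by blast+
  have h8: "nv a \<bullet> (a \<bullet> (b \<bullet> a)) \<noteq> b \<bullet> a"
    using nflex by (simp add: flex_lip lip_iff)
  have h9: "a \<bullet> (b \<bullet> (a \<bullet> b)) = (a \<bullet> b) \<bullet> (a \<bullet> b)"
    using abab bol_mul[of a b a] h1 by (simp add: assoc_def)
  have h10: "w \<noteq> a"
  proof
    assume "w = a"
    moreover have "w \<bullet> (a \<bullet> b) = (a \<bullet> a) \<bullet> b"
      by (simp add: h3)
    ultimately show False
      using nflex by (simp add: assoc_def)
  qed
  have "companion a b b = b \<bullet> c" "companion a b (a \<bullet> b) = (a \<bullet> b) \<bullet> c"
    using companion_mul_assoc[OF bab, of \<one>] companion_mul_assoc[OF abab, of \<one>] ab by (simp_all add: companion_def h4)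
  then have h11: "w \<bullet> (b \<bullet> c) = (a \<bullet> b) \<bullet> c"
    using companion_mul[of a b a b] by (simp add: h3)
  \<comment> \<open>Identities for all elements alternate with equations about the fixed ones. The
    inequalities \<open>h8\<close>, \<open>h10\<close> and \<open>h12\<close> discard alternatives
    on the way; \<open>h14\<close> gives the final contradiction.\<close>
  have s1: "x1 \<bullet> (x2 \<bullet> x3 \<bullet> x2) \<bullet> x3 = x1 \<bullet> x2 \<bullet> (x3 \<bullet> x2 \<bullet> x3)" for x1 x2 x3
    by (metis bol_mul)
  have s2: "x1 \<bullet> (x2 \<bullet> x3 \<bullet> x2) \<bullet> nv x2 = x1 \<bullet> x2 \<bullet> x3" for x1 x2 x3
    by (metis rip bol_mul rets)
  have s3: "x1 \<bullet> (x2 \<bullet> nv (x1 \<bullet> x2) \<bullet> x2) = ret x2" for x1 x2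
    by (metis bol_mul mul_nv one_mul rets)
  have s4: "nv (x1 \<bullet> x2 \<bullet> x1) \<bullet> (x1 \<bullet> (x2 \<bullet> x1)) = \<one> \<or> x2 \<bullet> x1 \<bullet> x2 = x2 \<bullet> (x1 \<bullet> x2)" for x1 x2
    by (metis mul_nv rip s2 bol_mul s1 hyp rets)
  have s5: "x1 \<bullet> x2 \<bullet> (x3 \<bullet> nv (x2 \<bullet> x3) \<bullet> x3) = x1 \<bullet> (x3 \<bullet> x2) \<bullet> nv x2" for x1 x2 x3
    by (metis s2 s3 rets)
  have s6: "x1 \<bullet> nv (x2 \<bullet> x3 \<bullet> x2) \<bullet> x2 = x1 \<bullet> nv x2 \<bullet> nv x3" for x1 x2 x3
    by (metis s2 nv_triple nv_nv rets)
  have s7: "x1 \<bullet> (x2 \<bullet> x1) \<bullet> nv (x1 \<bullet> x2 \<bullet> x1) = \<one> \<or> x2 \<bullet> x1 \<bullet> x2 = x2 \<bullet> (x1 \<bullet> x2)" for x1 x2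
    by (metis nv_mul_triple s4 nv_nv one_mul mul_nv rets)
  have s8: "x1 \<bullet> (x2 \<bullet> x3) \<bullet> nv x3 \<bullet> nv x2 = x1 \<bullet> x3 \<bullet> x2 \<bullet> nv (x3 \<bullet> x2)" for x1 x2 x3
    by (metis s2 s5)
  have s9: "x1 \<bullet> x1 \<bullet> x2 \<bullet> nv (x1 \<bullet> x2) = ret x1 \<or> x2 \<bullet> x1 \<bullet> x2 = x2 \<bullet> (x1 \<bullet> x2)" for x1 x2
    by (metis s6 s7 one_mul s8 rets)
  \<comment> \<open>The hypothesis with one alternative in left alternative form.\<close>
  have s10: "x1 \<bullet> x2 \<bullet> x1 = x1 \<bullet> (x2 \<bullet> x1) \<or> x2 \<bullet> x2 \<bullet> x1 = x2 \<bullet> (x2 \<bullet> x1)" for x1 x2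
    by (metis rip s9 nv_nv rets)
  have s11: "x1 \<bullet> (x1 \<bullet> x2) \<bullet> nv x2 = x1 \<bullet> x1 \<or> x2 \<bullet> x1 \<bullet> x2 = x2 \<bullet> (x1 \<bullet> x2)" for x1 x2
    by (metis rip s10 rets)
  have s12: "x1 \<bullet> x2 \<bullet> x1 \<bullet> nv (x2 \<bullet> x1) = ret x1 \<or> x2 \<bullet> x1 \<bullet> x2 = x2 \<bullet> (x1 \<bullet> x2)" for x1 x2
    by (metis s8 s11 rip rets)
  have s13: "nv (x1 \<bullet> x2 \<bullet> x1) \<bullet> x1 = nv x1 \<bullet> nv x2" for x1 x2
    by (metis rip nv_triple nv_nv rets)
  have s14: "x1 \<bullet> nv (x1 \<bullet> x1) = nv x1" for x1
    by (metis rip right_alt mul_nv one_mul rets)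
  have s15: "b \<bullet> nv (d \<bullet> b) = a"
    by (metis rip h2 rets)
  \<comment> \<open>The alternative \<open>x1 nv (x2 x1) = nv x2\<close>, frequent below, is the
    left inverse property at \<open>(x2, x1)\<close>.\<close>
  have s16: "x1 \<bullet> x2 \<bullet> (nv x2 \<bullet> (x1 \<bullet> x2)) = x1 \<bullet> (x1 \<bullet> x2) \<or> x1 \<bullet> nv (x2 \<bullet> x1) = nv x2" for x1 x2
    by (metis s12 rip s8 mul_nv one_mul rets)
  have s17: "b \<bullet> nv (b \<bullet> (a \<bullet> b)) = nv a \<bullet> nv b"
    by (metis s13 rip nv_nv nv_mul_triple h1 rets)
  have s18: "nv (d \<bullet> b) \<bullet> b = nv b \<bullet> (a \<bullet> b)"
    by (metis nv_mul_triple s15)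
  have s19: "x1 \<bullet> (x2 \<bullet> x2) \<bullet> x1 \<bullet> nv (x2 \<bullet> x1) = x1 \<bullet> x2 \<or> x1 \<bullet> nv (x2 \<bullet> x1) = nv x2" for x1 x2
    by (metis s8 s16 rip nv_nv right_alt rets)
  have s20: "nv a \<bullet> (b \<bullet> a) = d \<bullet> b \<bullet> a"
    by (metis nv_mul_triple h2)
  have s21: "nv (x1 \<bullet> x2 \<bullet> x1) \<bullet> (x1 \<bullet> (x2 \<bullet> x1)) = \<one> \<or> x2 \<bullet> x2 \<bullet> x1 = x2 \<bullet> (x2 \<bullet> x1)" for x1 x2
    by (metis mul_nv rip s2 bol_mul s1 s10 rets)
  have s22: "x1 \<bullet> (nv x2 \<bullet> x3 \<bullet> nv x2) \<bullet> x2 = x1 \<bullet> nv x2 \<bullet> x3" for x1 x2 x3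
    by (metis rip' bol_mul rets)
  have s23: "nv x1 \<bullet> (x2 \<bullet> (x1 \<bullet> nv x2) \<bullet> x2) = nv (nv x2 \<bullet> x1) \<bullet> x1" for x1 x2
    by (metis s13 nv_nv rip' rip nv_mul_triple rets)
  have s24: "x1 \<bullet> (a \<bullet> b) \<bullet> nv b = x1 \<bullet> b \<bullet> nv (d \<bullet> b)" for x1
    by (metis s2 s15)
  have s25: "nv a \<bullet> nv (d \<bullet> b) = nv (b \<bullet> a) \<bullet> a"
    by (metis s13 h2)
  have s26: "x1 \<bullet> b \<bullet> nv (b \<bullet> (a \<bullet> b)) = x1 \<bullet> nv a \<bullet> nv b" for x1
    by (metis s2 s17 rip' rets)
  have s27: "nv (x1 \<bullet> x1) \<bullet> (x1 \<bullet> x2 \<bullet> x1) = nv x1 \<bullet> x2 \<bullet> x1" for x1 x2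
    by (metis bol_mul nv_mul_triple s14 mul_nv one_mul rets)
  have s28: "nv x1 \<bullet> nv x1 = nv (x1 \<bullet> x1)" for x1
    by (metis rip nv_mul_triple s14 mul_nv one_mul rets)
  have s29: "x1 \<bullet> (x2 \<bullet> x2) \<bullet> x1 = x1 \<bullet> x2 \<bullet> (x2 \<bullet> x1) \<or> x1 \<bullet> nv (x2 \<bullet> x1) = nv x2" for x1 x2
    by (metis rip s19 nv_nv rets)
  have s30: "x1 \<bullet> nv (x1 \<bullet> x2 \<bullet> x1) = nv x2 \<bullet> nv x1" for x1 x2
    by (metis nv_mul_triple nv_triple nv_nv rets)
  have s31: "nv x1 \<bullet> nv x2 \<bullet> (x1 \<bullet> x2) = nv (x2 \<bullet> x1) \<bullet> x1 \<bullet> x2" for x1 x2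
    by (metis s22 s23 nv_nv rets)
  have s32: "nv (b \<bullet> a) \<bullet> a = c \<bullet> nv b"
    by (metis s24 h4 rip' s25 rets)
  have s33: "x1 \<bullet> x2 \<bullet> nv (x2 \<bullet> x2) = x1 \<bullet> nv x2" for x1 x2
    by (metis rip right_alt rip' rets)
  have s34: "b \<bullet> b \<bullet> nv (d \<bullet> b) = b \<bullet> a"
    by (metis s27 s28 nv_nv rip s18 h1 rets)
  have s35: "nv (x1 \<bullet> nv x2) \<bullet> (x1 \<bullet> x2 \<bullet> (x1 \<bullet> nv x2)) = x2 \<bullet> x2 \<bullet> (x1 \<bullet> nv x2)" for x1 x2
    by (metis nv_mul_triple right_alt rip' rets)
  have s36: "x1 \<bullet> x2 \<bullet> (x2 \<bullet> x1 \<bullet> x2) = x1 \<bullet> (x2 \<bullet> (x2 \<bullet> x1) \<bullet> x2) \<or> x1 \<bullet> nv (x2 \<bullet> x1) = nv x2" for x1 x2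
    by (metis s29 bol_mul right_alt)
  have s37: "x1 \<bullet> x2 \<bullet> nv (x2 \<bullet> x3 \<bullet> x2) = x1 \<bullet> nv x3 \<bullet> nv x2" for x1 x2 x3
    by (metis s2 s30 rip' rets)
  have s38: "nv (x1 \<bullet> x2 \<bullet> x1) \<bullet> nv x2 = nv x1 \<bullet> nv (x2 \<bullet> x1 \<bullet> x2)" for x1 x2
    by (metis bol_mul nv_triple)
  have s39: "nv (nv x1 \<bullet> x2 \<bullet> nv x1) = x1 \<bullet> nv x2 \<bullet> x1" for x1 x2
    by (metis nv_triple nv_nv rets)
  have s40: "x1 \<bullet> x1 \<bullet> x2 \<bullet> nv (x1 \<bullet> x2) = ret x1 \<or> x2 \<bullet> x2 \<bullet> x1 = x2 \<bullet> (x2 \<bullet> x1)" for x1 x2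
    by (metis s6 one_mul s8 nv_mul_triple s21 nv_nv mul_nv rets)
  have s41: "x1 \<bullet> x2 \<bullet> nv (x1 \<bullet> (x1 \<bullet> x2)) = x2 \<bullet> nv (x1 \<bullet> x2)" for x1 x2
    by (metis s30 rip nv_nv rets)
  have s42: "d \<bullet> (nv b \<bullet> (a \<bullet> b)) = c"
    by (metis s31 s18 nv_nv rip s15 s25 s32 rip' rets)
  have s43: "a \<bullet> nv b \<bullet> (a \<bullet> b) = w \<bullet> (nv b \<bullet> (a \<bullet> b))"
    by (metis bol_mul s26 mul_nv one_mul rip h3 nv_nv rets)
  have s44: "b \<bullet> a \<bullet> (d \<bullet> b) = b \<bullet> b"
    by (metis rip s34 nv_nv rets)
  have s45: "a \<bullet> (d \<bullet> (d \<bullet> b)) = d \<bullet> b"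
    by (metis s3 h2 rip rets)
  have s46: "nv x1 \<bullet> (x1 \<bullet> x2 \<bullet> x1 \<bullet> x3 \<bullet> (x1 \<bullet> x2 \<bullet> x1)) = x2 \<bullet> x1 \<bullet> x3 \<bullet> (x1 \<bullet> x2 \<bullet> x1)" for x1 x2 x3
    by (metis bol_mul nv_mul_triple)
  have s47: "x1 \<bullet> (x2 \<bullet> (x1 \<bullet> x1) \<bullet> x2) = x1 \<bullet> (x2 \<bullet> x1 \<bullet> (x1 \<bullet> x2)) \<or> x2 \<bullet> nv (x1 \<bullet> x2) = nv x1" for x1 x2
    by (metis s35 s36 s37 mul_nv one_mul nv_nv s2 right_alt bol_mul rets)
  have s48: "x1 \<bullet> nv x2 \<bullet> (x2 \<bullet> x3 \<bullet> x2) = x1 \<bullet> x3 \<bullet> x2" for x1 x2 x3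
    by (metis bol_mul rip' rets)
  have s49: "nv a \<bullet> (b \<bullet> (b \<bullet> a)) = d \<bullet> b \<bullet> (b \<bullet> a)"
    by (metis s38 nv_nv s39 rip s13 s20 rets)
  have s50: "x1 \<bullet> (b \<bullet> a) \<bullet> nv a = x1 \<bullet> a \<bullet> (d \<bullet> b)" for x1
    by (metis s2 h2)
  have s51: "d \<bullet> (w \<bullet> (nv b \<bullet> (a \<bullet> b))) = nv b \<bullet> (a \<bullet> b)"
    by (metis s43 s33 s14 bol_mul h5)
  have s52: "x1 \<bullet> (d \<bullet> b) \<bullet> nv b = x1 \<bullet> b \<bullet> nv (a \<bullet> b)" for x1
    by (metis s2 h7)
  have s53: "nv x1 \<bullet> (x1 \<bullet> x2 \<bullet> (x2 \<bullet> x1)) = x2 \<bullet> x2 \<bullet> x1 \<or> x1 \<bullet> x2 \<bullet> x1 \<bullet> nv (x2 \<bullet> x1) = ret x1" for x1 x2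
    by (metis s46 s47 rip nv_mul_triple s28 s33 s48 nv_nv rets)
  have s54: "a \<bullet> (d \<bullet> b \<bullet> a \<bullet> (d \<bullet> b)) = b \<bullet> b"
    by (metis nv_mul_triple s49 nv_nv s50 s44 rets)
  have s55: "c \<bullet> nv (d \<bullet> c) = w"
    by (metis s41 s51 s42 rip rets)
  have s56: "a \<bullet> b \<bullet> nv (b \<bullet> (a \<bullet> b)) = nv b"
    by (metis rip nv_mul_triple h1 rets)
  have s57: "b \<bullet> (b \<bullet> a) \<bullet> nv (d \<bullet> b \<bullet> a) = b \<bullet> a"
    by (metis rip s20 h6 rets)
  have s58: "a \<bullet> nv (d \<bullet> b \<bullet> a) \<bullet> a = nv (d \<bullet> (d \<bullet> b))"
    by (metis s39 rip nv_mul_triple s45 rets)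
  have s59: "a \<bullet> b \<bullet> nv (d \<bullet> b) = b \<bullet> nv (d \<bullet> (d \<bullet> b))"
    by (metis s38 s52 mul_nv one_mul nv_nv rip rets)
  have s60: "nv x1 \<bullet> (x1 \<bullet> x2 \<bullet> (x2 \<bullet> x1)) = x2 \<bullet> x2 \<bullet> x1 \<or> x1 \<bullet> (x1 \<bullet> x2) \<bullet> nv x2 = x1 \<bullet> x1" for x1 x2
    by (metis bol_mul s53 s5 rets)
  have s61: "x1 \<bullet> nv (x2 \<bullet> x1) \<bullet> (x2 \<bullet> (x2 \<bullet> x1)) = x2 \<bullet> x1" for x1 x2
    by (metis rip s41 nv_nv rets)
  have s62: "d \<bullet> b \<bullet> a \<bullet> nv (b \<bullet> a) = nv a"
    by (metis rip s20 rets)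
  have s63: "x1 \<bullet> x2 \<bullet> x1 \<bullet> nv (x2 \<bullet> x1) = ret x1 \<or> x2 \<bullet> x2 \<bullet> x1 = x2 \<bullet> (x2 \<bullet> x1)" for x1 x2
    by (metis s8 rip s40 nv_nv rets)
  have s64: "x1 \<bullet> (nv x1 \<bullet> x2 \<bullet> nv x1) = x2 \<bullet> nv x1" for x1 x2
    by (metis nv_mul_triple nv_nv rets)
  \<comment> \<open>Both sides are the companion of \<open>a\<close>.\<close>
  have s65: "nv b \<bullet> (a \<bullet> b) = w \<bullet> c"
    by (metis s55 rip nv_nv s41 s42 rets)
  have s66: "b \<bullet> (nv b \<bullet> (a \<bullet> b)) = a \<bullet> b"
    by (metis s56 nv_nv rip nv_triple nv_mul_triple rets)
  have s67: "b \<bullet> b \<bullet> nv (d \<bullet> (d \<bullet> b)) = b \<bullet> (a \<bullet> a)"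
    by (metis s57 right_alt s58 bol_mul s44 h2)
  have s68: "x1 \<bullet> nv (a \<bullet> b) \<bullet> b = x1 \<bullet> nv b \<bullet> (d \<bullet> b)" for x1
    by (metis s48 h7)
  have s69: "x1 \<bullet> (b \<bullet> (a \<bullet> b)) \<bullet> nv b = x1 \<bullet> b \<bullet> a" for x1
    by (metis s2 h1)
  have s70: "a \<bullet> (d \<bullet> (b \<bullet> b)) = b \<bullet> b"
    by (metis s61 s62 h8 s54 hyp h2 right_alt)
  have s71: "x1 \<bullet> x2 \<bullet> (x1 \<bullet> x2) \<bullet> nv x2 = x1 \<bullet> x2 \<bullet> x1 \<or> x1 \<bullet> nv (x2 \<bullet> x1) = nv x2" for x1 x2
    by (metis s63 rip s8 mul_nv one_mul rets)
  have s72: "x1 \<bullet> nv x2 \<bullet> x3 \<bullet> nv (nv x2 \<bullet> x3) = x1 \<bullet> (x3 \<bullet> nv x2) \<bullet> x2 \<bullet> nv x3" for x1 x2 x3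
    by (metis s6 s8 s22 rip' s64 nv_nv rets)
  have s73: "b \<bullet> a \<bullet> nv b \<bullet> (a \<bullet> b) = b \<bullet> (w \<bullet> (w \<bullet> c))"
    by (metis bol_mul s33 s43 s65 h1)
  have s74: "x1 \<bullet> (x2 \<bullet> (x2 \<bullet> x3)) \<bullet> nv (x2 \<bullet> x3) = x1 \<bullet> (x2 \<bullet> x3) \<bullet> nv x3" for x1 x2 x3
    by (metis s2 rip rets)
  have s75: "b \<bullet> (w \<bullet> c) = a \<bullet> b"
    by (metis s66 s65)
  have s76: "b \<bullet> (a \<bullet> a) \<bullet> b = b \<bullet> (a \<bullet> (a \<bullet> b))"
    by (metis bol_mul s67 s59 rip s48 s15 rets)
  have s77: "a \<bullet> b \<bullet> a \<bullet> (d \<bullet> b) = a \<bullet> (b \<bullet> b)"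
    by (metis s68 right_alt s69 rip h9 rets)
  have s78: "x1 \<bullet> (x2 \<bullet> x2) \<bullet> x1 = x1 \<bullet> x2 \<bullet> (x2 \<bullet> x1) \<or> x1 \<bullet> (x1 \<bullet> x2) \<bullet> nv x2 = x1 \<bullet> x1" for x1 x2
    by (metis rip nv_nv nv_mul_triple s60 rets)
  have s79: "d \<bullet> (b \<bullet> b) \<bullet> a = d \<bullet> b \<bullet> (b \<bullet> a)"
    by (metis nv_mul_triple s70 s49 bol_mul s44 h2)
  have s80: "x1 \<bullet> x2 \<bullet> (x1 \<bullet> x2) = x1 \<bullet> (x2 \<bullet> x1 \<bullet> x2) \<or> x1 \<bullet> nv (x2 \<bullet> x1) = nv x2" for x1 x2
    by (metis rip s71 nv_nv bol_mul rets)
  have s81: "x1 \<bullet> x2 \<bullet> (nv x2 \<bullet> x3 \<bullet> nv x2) = x1 \<bullet> x3 \<bullet> nv x2" for x1 x2 x3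
    by (metis bol_mul rip rets)
  have s82: "x1 \<bullet> x2 \<bullet> nv (nv x2 \<bullet> (x1 \<bullet> x2)) = x2 \<bullet> x1 \<bullet> x2 \<bullet> nv (x1 \<bullet> x2)" for x1 x2
    by (metis s41 nv_mul_triple)
  \<comment> \<open>Thus \<open>c\<close> is a commutator: \<open>a b = (b a) c\<close>.\<close>
  have s83: "a \<bullet> b \<bullet> nv c = b \<bullet> a"
    by (metis s72 s73 s65 s74 s75 rip right_alt s76 s24 s34 rets)
  have s84: "x1 \<bullet> (x2 \<bullet> x2) \<bullet> x1 = x1 \<bullet> x2 \<bullet> (x2 \<bullet> x1) \<or> x1 \<bullet> x2 \<bullet> x1 \<bullet> nv (x2 \<bullet> x1) = ret x1" for x1 x2
    by (metis s8 s78 rip rets)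
  have s85: "x1 \<bullet> nv (x2 \<bullet> x1) \<bullet> x1 \<bullet> x2 = nv x2 \<bullet> (x1 \<bullet> x2)" for x1 x2
    by (metis nv_mul_triple s3 rets)
  have s86: "x1 \<bullet> (x2 \<bullet> nv (x1 \<bullet> x2) \<bullet> x2 \<bullet> (x2 \<bullet> nv (x1 \<bullet> x2) \<bullet> x2)) = x2 \<bullet> (x2 \<bullet> nv (x1 \<bullet> x2) \<bullet> x2)" for x1 x2
    by (metis right_alt s3 rets)
  have s87: "x1 \<bullet> (x2 \<bullet> nv (x3 \<bullet> x2) \<bullet> x2) \<bullet> x3 = x1 \<bullet> nv x3 \<bullet> (x2 \<bullet> x3)" for x1 x2 x3
    by (metis s48 s3 rets)
  have s88: "d \<bullet> b \<bullet> a \<bullet> (d \<bullet> b) = d \<bullet> (b \<bullet> b)"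
    by (metis rip s79 s50 rets)
  have s89: "x1 \<bullet> x2 \<bullet> x1 \<bullet> nv (x2 \<bullet> x1) = ret x1 \<or> x2 \<bullet> (x2 \<bullet> x1) \<bullet> nv x1 = x2 \<bullet> x2" for x1 x2
    by (metis s80 rip s81 s82 nv_nv rets)
  have s90: "x1 \<bullet> (x2 \<bullet> nv (x1 \<bullet> x2 \<bullet> x3 \<bullet> (x1 \<bullet> x2)) \<bullet> x2) = nv x3 \<bullet> nv (x1 \<bullet> x2) \<bullet> x2" for x1 x2 x3
    by (metis bol_mul s30)
  have s91: "a \<bullet> nv (a \<bullet> b \<bullet> (b \<bullet> a)) = nv (b \<bullet> b) \<bullet> nv a"
    by (metis s30 bol_mul s77 h2)
  have s92: "x1 \<bullet> nv (x2 \<bullet> x3) \<bullet> (x2 \<bullet> (x2 \<bullet> x3)) = x1 \<bullet> nv x3 \<bullet> (x2 \<bullet> x3)" for x1 x2 x3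
    by (metis s48 rip rets)
  have s93: "x1 \<bullet> nv x2 \<bullet> (x1 \<bullet> x2) = x1 \<bullet> (nv x2 \<bullet> (x1 \<bullet> x2)) \<or> x2 \<bullet> x1 \<bullet> x2 \<bullet> nv (x1 \<bullet> x2) = ret x2" for x1 x2
    by (metis s84 s85 s86 s87 s3 s82 rets)
  have s94: "x1 \<bullet> x2 \<bullet> (x1 \<bullet> x2) = x1 \<bullet> (x2 \<bullet> x1 \<bullet> x2) \<or> x1 \<bullet> x2 \<bullet> x1 \<bullet> nv (x2 \<bullet> x1) = ret x1" for x1 x2
    by (metis s37 s89 s8 s2 bol_mul rets)
  have s95: "nv c \<bullet> nv (b \<bullet> a) \<bullet> a = nv b"
    by (metis s90 s91 rip' s14 rip s83 nv_nv rets)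
  have s96: "nv (a \<bullet> b) \<bullet> b = nv b \<bullet> (d \<bullet> b)"
    by (metis nv_mul_triple h7)
  have s97: "x1 \<bullet> nv x2 \<bullet> (x1 \<bullet> x2) = x1 \<bullet> (nv x2 \<bullet> (x1 \<bullet> x2)) \<or> x2 \<bullet> x1 \<bullet> (x1 \<bullet> x2) = x2 \<bullet> (x1 \<bullet> (x1 \<bullet> x2))" for x1 x2
    by (metis s92 s93 rip rets)
  have s98: "w \<bullet> b \<bullet> nv (d \<bullet> b) = a \<bullet> a"
    by (metis s24 rip h3 nv_nv rets)
  have s99: "d \<bullet> b \<bullet> (nv b \<bullet> (a \<bullet> b)) = b"
    by (metis s61 s18 nv_mul_triple s88 h2 rip right_alt rets)
  have s100: "nv x1 \<bullet> (x1 \<bullet> x2 \<bullet> (x1 \<bullet> x2 \<bullet> x1)) = x2 \<bullet> (x1 \<bullet> x2 \<bullet> x1)" for x1 x2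
    by (metis nv_mul_triple s1 bol_mul)
  have s101: "nv b \<bullet> (d \<bullet> b) = nv c \<bullet> nv a"
    by (metis s95 nv_nv s96 rip' s64 s5 rets)
  have s102: "x1 \<bullet> x2 \<bullet> (x2 \<bullet> x1) = x1 \<bullet> (x2 \<bullet> (x2 \<bullet> x1)) \<or> x2 \<bullet> x2 \<bullet> x1 \<bullet> nv (x2 \<bullet> x1) = ret x2" for x1 x2
    by (metis s72 s97 rip rets)
  have s103: "a \<bullet> a \<bullet> (d \<bullet> (d \<bullet> b)) = w \<bullet> (d \<bullet> b)"
    by (metis s92 s98 rip rets)
  have s104: "d \<bullet> b \<bullet> (w \<bullet> c) = b"
    by (metis s99 s65)
  \<comment> \<open>By the symmetries the first alternative is flexibility of
    \<open>(x1 x2, x1)\<close>; this is \<open>twist\<close> for arbitrary pairs.\<close>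
  have s105: "x1 \<bullet> x2 \<bullet> (x1 \<bullet> x2) = x1 \<bullet> (x2 \<bullet> x1 \<bullet> x2) \<or> nv x2 \<bullet> (x2 \<bullet> x1) = ret x1" for x1 x2
    by (metis nv_mul_triple rip s100 s94 nv_nv rets)
  have s106: "nv c \<bullet> nv a \<bullet> nv b = nv (a \<bullet> b)"
    by (metis s52 s101 mul_nv one_mul rets)
  have s107: "d \<bullet> (d \<bullet> b) \<bullet> b = d \<bullet> (d \<bullet> (b \<bullet> b))"
    by (metis s102 s45 bol_mul s88 h2 s103 rip h10 rets)
  have s108: "x1 \<bullet> (x2 \<bullet> x1 \<bullet> x2) \<bullet> nv (x1 \<bullet> x2) = x1 \<bullet> x2 \<or> nv x2 \<bullet> (x2 \<bullet> x1) = ret x1" for x1 x2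
    by (metis rip s105 rets)
  have s109: "nv (w \<bullet> c) \<bullet> (a \<bullet> b) = nv c \<bullet> b"
    by (metis s106 nv_nv s65 rip rip' s64 s5 rets)
  have s110: "w \<bullet> c \<bullet> nv (a \<bullet> b) = nv b"
    by (metis rip s65 rets)
  have s111: "d \<bullet> b \<bullet> nv (w \<bullet> c) = d \<bullet> (d \<bullet> b)"
    by (metis rip s107 s74 s104 right_alt rets)
  have s112: "x1 \<bullet> x2 \<bullet> (x2 \<bullet> x1) \<bullet> nv x1 = x1 \<bullet> (x2 \<bullet> x2) \<or> nv x2 \<bullet> (x2 \<bullet> x1) = ret x1" for x1 x2
    by (metis s108 right_alt s5 bol_mul rets)
  have s113: "nv (x1 \<bullet> nv x2 \<bullet> x1) = nv x1 \<bullet> x2 \<bullet> nv x1" for x1 x2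
    by (metis nv_triple nv_nv rets)
  have s114: "nv (d \<bullet> b) \<bullet> (b \<bullet> b) = nv b \<bullet> (a \<bullet> (b \<bullet> b))"
    by (metis nv_mul_triple s66 right_alt s18)
  have s115: "x1 \<bullet> (x2 \<bullet> (x3 \<bullet> nv (x1 \<bullet> x2 \<bullet> x3) \<bullet> x3) \<bullet> x2) = x3 \<bullet> x2" for x1 x2 x3
    by (metis bol_mul s3 rets)
  have s116: "nv (x1 \<bullet> x2) \<bullet> x2 \<bullet> nv (x1 \<bullet> x2) = nv (x1 \<bullet> (x1 \<bullet> x2))" for x1 x2
    by (metis s113 rip' nv_nv rets)
  have s117: "d \<bullet> b \<bullet> (d \<bullet> b) = d \<bullet> (b \<bullet> (d \<bullet> b))"
    by (metis bol_mul s104 rip s111 nv_nv rets)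
  have s118: "w \<bullet> c \<bullet> b = a \<bullet> (c \<bullet> b)"
    by (metis rip nv_nv s8 h11 rets)
  have s119: "x1 \<bullet> (nv (x2 \<bullet> x1) \<bullet> x1 \<bullet> x2) = nv x2 \<bullet> (x1 \<bullet> x2) \<or> x2 \<bullet> x1 \<bullet> x2 = x2 \<bullet> (x1 \<bullet> x2)" for x1 x2
    by (metis s115 s11 nv_triple s37 s14 s31)
  have s120: "nv (nv b \<bullet> (w \<bullet> c)) \<bullet> (w \<bullet> c) = nv c \<bullet> b"
    by (metis rip nv_nv s39 s109 s110 rets)
  have s121: "w \<bullet> c \<bullet> nv b = nv (d \<bullet> b)"
    by (metis s24 s65 mul_nv one_mul rets)
  have s122: "nv b \<bullet> (w \<bullet> c) \<bullet> nv b = nv (d \<bullet> (b \<bullet> b))"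
    by (metis s116 s104 right_alt)
  have s123: "nv b \<bullet> (a \<bullet> (b \<bullet> (a \<bullet> b))) = w \<bullet> c \<bullet> (a \<bullet> b)"
    by (metis right_alt s65 h9)
  have s124: "nv (x1 \<bullet> (x2 \<bullet> x2) \<bullet> x1) = nv (x1 \<bullet> x2 \<bullet> (x2 \<bullet> x1)) \<or> nv x2 \<bullet> (x2 \<bullet> x1) = ret x1" for x1 x2
    by (metis rip nv_triple s13 s112 nv_nv rets)
  have s125: "nv x1 \<bullet> (x1 \<bullet> x2 \<bullet> x1 \<bullet> (x1 \<bullet> x2 \<bullet> x1)) = x2 \<bullet> x1 \<bullet> (x1 \<bullet> x2 \<bullet> x1)" for x1 x2
    by (metis right_alt nv_mul_triple)
  have s126: "nv b \<bullet> (a \<bullet> (b \<bullet> b)) = a \<bullet> (c \<bullet> b)"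
    by (metis s65 s118 s114 right_alt s18)
  have s127: "nv b \<bullet> nv (d \<bullet> b) = nv (d \<bullet> (b \<bullet> b))"
    by (metis s119 s120 rip nv_nv s121 s15 s122 h10 rets)
  have s128: "a \<bullet> c \<bullet> a \<bullet> b = w \<bullet> c \<bullet> (a \<bullet> b)"
    by (metis nv_mul_triple bol_mul h1 s123 rip s83 nv_nv rets)
  have s129: "nv (x1 \<bullet> (x2 \<bullet> x2) \<bullet> x1) = nv (x1 \<bullet> x2 \<bullet> (x2 \<bullet> x1)) \<or> nv (x2 \<bullet> x1 \<bullet> x2) \<bullet> (x2 \<bullet> x1) = nv x2" for x1 x2
    by (metis s124 s125 s2 right_alt nv_mul_triple rip rets)
  \<comment> \<open>Because \<open>b nv (d b) = a\<close>, this is the left inverse property at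
    \<open>(b, a)\<close>.\<close>
  have s130: "nv (d \<bullet> b) = nv b \<bullet> a"
    by (metis s3 s127 nv_nv s15 nv_mul_triple s88 h2 rets)
  have s131: "x1 \<bullet> (b \<bullet> d) \<bullet> nv d = x1 \<bullet> d \<bullet> (a \<bullet> b)" for x1
    by (metis s2 h5)
  have s132: "b \<bullet> d \<bullet> b = b \<bullet> (d \<bullet> b) \<or> nv b \<bullet> (b \<bullet> d) = d"
    by (metis rip s2 nv_mul_triple bol_mul s105 s117 rets)
  have s133: "nv b \<bullet> a \<bullet> (b \<bullet> b) = a \<bullet> (c \<bullet> b)"
    by (metis s130 s114 s126)
  have s134: "a \<bullet> (c \<bullet> b) \<bullet> (nv b \<bullet> a) = a \<bullet> c \<bullet> a"
    by (metis s130 rip s128 s24 s118 rets)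
  have s135: "nv b \<bullet> a \<bullet> b = w \<bullet> c"
    by (metis s130 s18 s65)
  have s136: "nv (w \<bullet> c \<bullet> a) = nv (a \<bullet> c \<bullet> a) \<or> nv b \<bullet> nv a = nv (a \<bullet> b)"
    by (metis s133 s134 s135 rip s129 s15 s130 rets)
  have s137: "x1 \<bullet> nv (a \<bullet> b) = x1 \<bullet> (nv b \<bullet> d) \<or> b \<bullet> d \<bullet> b = b \<bullet> (d \<bullet> b)" for x1
    by (metis s74 one_mul s131 s132 mul_nv rets)
  \<comment> \<open>The antiautomorphic inverse property at \<open>(a, b)\<close>.\<close>
  have s138: "nv b \<bullet> nv a = nv (a \<bullet> b)"
    by (metis s3 s136 s30 rip' rip h10 rets)
  have s139: "a \<bullet> (d \<bullet> nv b \<bullet> (d \<bullet> b)) = nv b \<bullet> (d \<bullet> b)"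
    by (metis s33 s14 bol_mul h2)
  have s140: "nv (x1 \<bullet> x2) \<bullet> (x1 \<bullet> (x1 \<bullet> x2)) = nv x2 \<bullet> (x1 \<bullet> x2)" for x1 x2
    by (metis nv_mul_triple rip rets)
  have s141: "b \<bullet> d \<bullet> b = b \<bullet> (d \<bullet> b) \<or> nv b \<bullet> d \<bullet> a = nv b"
    by (metis nv_mul_triple s137 rip s138 nv_nv rets)
  have s142: "b \<bullet> (nv b \<bullet> (d \<bullet> b) \<bullet> a) = d \<bullet> b \<bullet> a"
    by (metis bol_mul s139 s3 s44 s33 rets)
  have s143: "a \<bullet> b \<bullet> nv (w \<bullet> c) = b"
    by (metis s82 s65 h1 rip rets)
  have s144: "b \<bullet> (a \<bullet> a) \<bullet> (d \<bullet> b) = b \<bullet> (a \<bullet> b)"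
    by (metis s67 s34 h1 s48 s41 rip' rets)
  have s145: "d \<bullet> b \<bullet> a = b \<bullet> nv c"
    by (metis s142 s101 rip' rets)
  have s146: "b \<bullet> (nv (a \<bullet> b) \<bullet> (w \<bullet> c)) = c"
    by (metis s110 nv_nv h7 s143 s31 s3 s55 rets)
  have s147: "x1 \<bullet> x2 \<bullet> (x1 \<bullet> x2) \<bullet> nv x2 = x1 \<bullet> x2 \<bullet> x1 \<or> x1 \<bullet> nv (nv x2 \<bullet> x1) = ret x2" for x1 x2
    by (metis rip nv_nv nv_mul_triple s10 rets)
  \<comment> \<open>The other alternative of \<open>s141\<close> would give
    \<open>nv b d = nv b nv a\<close>, against \<open>h12\<close>.\<close>
  have s148: "b \<bullet> d \<bullet> b = b \<bullet> (d \<bullet> b)"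
    by (metis rip nv_nv rip' h12 s140 s141 s64 rets)
  have s149: "nv (x1 \<bullet> x2 \<bullet> x1) \<bullet> nv x1 \<bullet> nv x2 = nv x1 \<bullet> nv (x2 \<bullet> (x1 \<bullet> x1) \<bullet> x2)" for x1 x2
    by (metis bol_mul nv_triple right_alt s28)
  have s150: "b \<bullet> a \<bullet> (b \<bullet> a) = b \<bullet> (a \<bullet> b \<bullet> a)"
    by (metis s144 h2 bol_mul right_alt h1)
  have s151: "x1 \<bullet> nv (x2 \<bullet> x1) \<bullet> x1 = nv x2 \<bullet> (x1 \<bullet> x2) \<bullet> nv x2" for x1 x2
    by (metis s39 nv_left_quot)
  have s152: "x1 \<bullet> (x2 \<bullet> x3) \<bullet> nv (x2 \<bullet> (x2 \<bullet> x3)) = x1 \<bullet> x3 \<bullet> nv (x2 \<bullet> x3)" for x1 x2 x3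
    by (metis s2 s41 rip' rets)
  have s153: "x1 \<bullet> x2 \<bullet> x1 \<bullet> (x1 \<bullet> x2) = x1 \<bullet> x2 \<bullet> (x1 \<bullet> (x1 \<bullet> x2)) \<or> x1 \<bullet> nv (nv x2 \<bullet> x1) = ret x2" for x1 x2
    by (metis bol_mul s147 rip rets)
  have s154: "d \<bullet> (b \<bullet> b) \<bullet> nv (a \<bullet> b) = b \<bullet> nv (w \<bullet> (w \<bullet> c))"
    by (metis s149 s65 s121 nv_nv right_alt s28 s33 s43 rets)
  have s155: "nv (x1 \<bullet> x2) \<bullet> (x2 \<bullet> x2) \<bullet> nv (x1 \<bullet> x2) = nv (x1 \<bullet> nv x2 \<bullet> (x1 \<bullet> x2))" for x1 x2
    by (metis s113 s33)
  have s156: "nv b \<bullet> (b \<bullet> a) = a"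
    by (metis s3 h2 nv_nv s130 rets)
  have s157: "nv a \<bullet> (b \<bullet> (a \<bullet> b \<bullet> a)) = d \<bullet> b \<bullet> a \<bullet> (b \<bullet> a)"
    by (metis right_alt s20 s150)
  have s158: "b \<bullet> nv c \<bullet> a \<bullet> (d \<bullet> b) = b \<bullet> nv c \<bullet> b"
    by (metis s29 s145 h2 rip h12 right_alt rets)
  have s159: "x1 \<bullet> nv (x2 \<bullet> nv x3) \<bullet> nv x3 \<bullet> x2 = x1 \<bullet> x3 \<bullet> nv x2 \<bullet> (nv x3 \<bullet> x2)" for x1 x2 x3
    by (metis s87 s81)
  have s160: "x1 \<bullet> (x2 \<bullet> x1 \<bullet> x2) \<bullet> nv (x1 \<bullet> x2) = x1 \<bullet> x2 \<or> x1 \<bullet> nv (nv x2 \<bullet> x1) = ret x2" for x1 x2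
    by (metis s152 s153 rip bol_mul rets)
  have s161: "nv d \<bullet> nv b \<bullet> (b \<bullet> (d \<bullet> b)) = b"
    by (metis rip nv_nv s30 s148 rets)
  have s162: "d \<bullet> (b \<bullet> (d \<bullet> b)) \<bullet> nv b = b \<bullet> nv (w \<bullet> (w \<bullet> c))"
    by (metis s52 s117 right_alt s154)
  have s163: "b \<bullet> d \<bullet> (a \<bullet> b \<bullet> d) = b \<bullet> (b \<bullet> d)"
    by (metis h13 rip nv_mul_triple h5 rets)
  have s164: "nv (nv b \<bullet> nv (b \<bullet> a) \<bullet> a) = b \<bullet> nv c \<bullet> b"
    by (metis s155 s156 s150 s157 s145 s50 s158)
  have s165: "nv (x1 \<bullet> x2) \<bullet> (nv x2 \<bullet> (x1 \<bullet> x2)) = nv (x2 \<bullet> x1 \<bullet> x2) \<bullet> (x1 \<bullet> x2)" for x1 x2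
    by (metis s140 nv_mul_triple)
  have s166: "nv (nv (a \<bullet> b) \<bullet> (w \<bullet> c)) = b \<bullet> nv (c \<bullet> b) \<bullet> b"
    by (metis s113 s151 rip nv_mul_triple s146 rets)
  have s167: "x1 \<bullet> nv x2 \<bullet> (nv x2 \<bullet> x1) = x1 \<bullet> nv (x2 \<bullet> x2) \<bullet> x1 \<or> x1 \<bullet> nv (x2 \<bullet> x1) = nv x2" for x1 x2
    by (metis s159 s160 right_alt s28 s22 rip nv_nv rets)
  have s168: "b \<bullet> nv (w \<bullet> (w \<bullet> c)) = d \<bullet> b \<bullet> d"
    by (metis s161 rip' nv_nv s162 nv_triple s116 s152 rets)
  have s169: "w \<bullet> (d \<bullet> c) = c"
    by (metis s51 rip s42 s92 s41 mul_nv one_mul rets)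
  have s170: "b \<bullet> (d \<bullet> d) \<bullet> b \<bullet> nv (d \<bullet> b) = b \<bullet> d"
    by (metis s8 s163 s131 rip right_alt h5 s24 rets)
  have s171: "d \<bullet> nv (b \<bullet> d) \<bullet> d = nv (a \<bullet> b)"
    by (metis rip nv_nv s13 nv_mul_triple h5 rets)
  have s172: "nv x1 \<bullet> nv (x1 \<bullet> x2) \<bullet> x2 \<bullet> x1 = nv (x1 \<bullet> x2 \<bullet> x1) \<bullet> (x2 \<bullet> x1)" for x1 x2
    by (metis s48 s85 nv_mul_triple rip rets)
  have s173: "nv (b \<bullet> (a \<bullet> b)) \<bullet> (a \<bullet> b) = nv (a \<bullet> b) \<bullet> (w \<bullet> c)"
    by (metis s165 s65 h1)
  have s174: "d \<bullet> (w \<bullet> (w \<bullet> c)) = w \<bullet> c"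
    by (metis s169 rip s92 s41 mul_nv one_mul rets)
  have s175: "b \<bullet> b \<bullet> d = b \<bullet> (b \<bullet> d)"
    by (metis bol_mul h5 rip nv_nv s148 s52 rets)
  have s176: "nv d \<bullet> (b \<bullet> (b \<bullet> d)) = a \<bullet> b \<bullet> (b \<bullet> d)"
    by (metis s38 s171 nv_nv s39 rip rets)
  have s177: "nv (a \<bullet> b) \<bullet> (w \<bullet> c) = nv b \<bullet> c"
    by (metis s172 rip' h1 s173 nv_nv s164 s113 rets)
  have s178: "a \<bullet> b \<bullet> (w \<bullet> c) = a \<bullet> (a \<bullet> b)"
    by (metis rip nv_nv s85 s166 s5 s110 h11 rets)
  have s179: "x1 \<bullet> nv x2 \<bullet> (x1 \<bullet> x2) = x1 \<bullet> (nv x2 \<bullet> (x1 \<bullet> x2)) \<or> x2 \<bullet> (x1 \<bullet> x2) \<bullet> x1 = x2 \<bullet> (x1 \<bullet> x2 \<bullet> x1)" for x1 x2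
    by (metis nv_nv rip s100 s167 rip' s33 rets)
  have s180: "d \<bullet> b \<bullet> (w \<bullet> c \<bullet> d) = b \<bullet> d"
    by (metis bol_mul s174 rip s168 nv_nv rets)
  have s181: "b \<bullet> nv (b \<bullet> d \<bullet> (d \<bullet> b)) = nv (d \<bullet> d) \<bullet> nv b"
    by (metis s30 rip s170 nv_nv rets)
  have s182: "x1 \<bullet> (nv b \<bullet> a) \<bullet> b = x1 \<bullet> nv b \<bullet> (a \<bullet> b)" for x1
    by (metis s130 s48 s15)
  have s183: "a \<bullet> (b \<bullet> b) \<bullet> d = a \<bullet> b \<bullet> (b \<bullet> d)"
    by (metis s175 s176 nv_mul_triple s61 s70 rip rets)
  have s184: "a \<bullet> b \<bullet> (nv (a \<bullet> b) \<bullet> (w \<bullet> c)) = w \<bullet> c"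
    by (metis s3 s178 s152 s65 mul_nv one_mul rets)
  have s185: "nv b \<bullet> a \<bullet> (b \<bullet> (d \<bullet> b)) = w \<bullet> c \<bullet> (d \<bullet> b)"
    by (metis s130 nv_mul_triple s104)
  have s186: "nv (w \<bullet> c \<bullet> d) \<bullet> nv b \<bullet> (a \<bullet> b) = nv d"
    by (metis s90 s180 s181 rip' s14 s130 s182 rets)
  have s187: "a \<bullet> b \<bullet> d \<bullet> (a \<bullet> b) = a \<bullet> (b \<bullet> b)"
    by (metis rip s183 s131 rets)
  have s188: "x1 \<bullet> (c \<bullet> b) \<bullet> nv b = x1 \<bullet> b \<bullet> (nv b \<bullet> c)" for x1
    by (metis s2 s146 s177)
  have s189: "a \<bullet> b \<bullet> (nv b \<bullet> c) = w \<bullet> c"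
    by (metis s184 s177)
  have s190: "x1 \<bullet> (x2 \<bullet> x2) \<bullet> x1 = x1 \<bullet> x2 \<bullet> (x2 \<bullet> x1) \<or> nv x2 \<bullet> x1 \<bullet> x2 \<bullet> nv (x1 \<bullet> x2) = nv x2" for x1 x2
    by (metis s152 rip s179 nv_nv right_alt rets)
  have s191: "nv (nv c \<bullet> nv a) = w \<bullet> c"
    by (metis s116 s130 s185 s101 nv_mul_triple s148 rip rets)
  have s192: "nv (w \<bullet> c \<bullet> d) \<bullet> (w \<bullet> c) = a"
    by (metis s115 s186 nv_nv s187 s126 s188 s189 rip rets)
  have s193: "x1 \<bullet> (x2 \<bullet> x2) \<bullet> x1 = x1 \<bullet> x2 \<bullet> (x2 \<bullet> x1) \<or> nv x2 \<bullet> (x2 \<bullet> x1) \<bullet> nv x1 = \<one>" for x1 x2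
    by (metis bol_mul s190 mul_nv s5)
  have s194: "nv c \<bullet> nv a = nv (w \<bullet> c)"
    by (metis nv_nv s191 rets)
  have s195: "nv (w \<bullet> c \<bullet> d) = a \<bullet> nv (w \<bullet> c)"
    by (metis rip s192 rets)
  have s196: "nv (w \<bullet> (w \<bullet> c)) = nv (w \<bullet> c) \<bullet> d \<or> nv b \<bullet> d \<bullet> (a \<bullet> b) = \<one>"
    by (metis s193 h7 s155 s43 s65 s96 s101 s194 nv_nv rets)
  have s197: "nv (w \<bullet> (w \<bullet> c)) \<bullet> nv d = d \<bullet> (a \<bullet> nv (w \<bullet> c))"
    by (metis s195 s82 nv_nv s116 s41 s169 rip rets)
  have s198: "b \<bullet> nv (a \<bullet> (b \<bullet> (a \<bullet> b))) = d \<bullet> nv (a \<bullet> b)"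
    by (metis s33 h5 h9)
  have s199: "d \<bullet> (a \<bullet> nv (w \<bullet> c)) = nv (w \<bullet> c) \<or> nv b \<bullet> (b \<bullet> d) = d"
    by (metis s197 rip bol_mul s196 one_mul h5 rets)
  have s200: "nv (a \<bullet> c \<bullet> a) \<bullet> nv b = d \<bullet> nv (a \<bullet> b)"
    by (metis s30 bol_mul h1 s198 rip s83 nv_nv rets)
  have s201: "d \<bullet> nv (w \<bullet> c) \<bullet> a \<bullet> c = nv a \<or> nv b \<bullet> (b \<bullet> d) = d"
    by (metis s8 s199 nv_nv mul_nv one_mul rip s194 rets)
  have s202: "x1 \<bullet> (x2 \<bullet> x3) \<bullet> nv (nv x3 \<bullet> (x2 \<bullet> x3)) = x1 \<bullet> (x3 \<bullet> x2 \<bullet> x3) \<bullet> nv (x2 \<bullet> x3)" for x1 x2 x3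
    by (metis s6 s165 rip nv_nv rets)
  have s203: "d \<bullet> nv b \<bullet> (d \<bullet> b) = nv (a \<bullet> c \<bullet> a)"
    by (metis rip s200 nv_nv s68 rets)
  have s204: "x1 \<bullet> nv b \<bullet> (b \<bullet> (d \<bullet> b)) = x1 \<bullet> d \<bullet> b" for x1
    by (metis s48 s148)
  have s205: "nv x1 \<bullet> nv x2 \<bullet> (x1 \<bullet> (x1 \<bullet> x2)) = nv (x2 \<bullet> x1) \<bullet> x1 \<bullet> (x1 \<bullet> x2)" for x1 x2
    by (metis s1 rip s13 s3 s113 rets)
  have s206: "nv (a \<bullet> c \<bullet> a) \<bullet> (w \<bullet> c) = d \<bullet> d \<bullet> b \<bullet> (nv b \<bullet> a)"
    by (metis s202 s203 s101 s194 nv_nv s148 s204 s130 rets)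
  have s207: "d \<bullet> d \<bullet> b \<bullet> (nv b \<bullet> a) = d \<or> nv b \<bullet> (b \<bullet> d) = d"
    by (metis s206 rip' nv_nv s116 s201 rip rets)
  have s208: "nv b \<bullet> (d \<bullet> b) \<bullet> (b \<bullet> a) = nv (w \<bullet> c) \<bullet> b \<bullet> a"
    by (metis s65 s96 s205 s3 s113 s85 s13 rets)
  have s209: "d \<bullet> d \<bullet> b = d \<bullet> (d \<bullet> b) \<or> d \<bullet> nv (b \<bullet> d) = nv b"
    by (metis rip s207 nv_nv s130 rets)
  have s210: "nv (a \<bullet> b) \<bullet> nv b = nv (b \<bullet> (a \<bullet> b))"
    by (metis nv_triple s138 h1)
  have s211: "nv (w \<bullet> c) \<bullet> b = nv c \<bullet> (d \<bullet> b)"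
    by (metis rip s208 s101 s2 s20 nv_nv rets)
  have s212: "d \<bullet> d \<bullet> b = d \<bullet> (d \<bullet> b) \<or> nv a \<bullet> nv b = d \<bullet> nv b"
    by (metis s209 nv_nv s210 s17 nv_mul_triple s171 rets)
  have s213: "nv c \<bullet> (d \<bullet> b) \<bullet> x1 \<bullet> b = nv (w \<bullet> c) \<bullet> (b \<bullet> x1 \<bullet> b)" for x1
    by (metis bol_mul s211)
  have s214: "b \<bullet> nv (d \<bullet> (b \<bullet> (d \<bullet> b))) = a \<bullet> nv (d \<bullet> b)"
    by (metis s117 s33 h2)
  have s215: "nv c \<bullet> nv b \<bullet> (a \<bullet> b) = nv c \<bullet> (w \<bullet> c)"
    by (metis s213 s33 s130 s182 s117 s214 s43 s65 s140)
  have s216: "x1 \<bullet> (x2 \<bullet> nv x1) \<bullet> x1 \<bullet> nv x2 = x2 \<bullet> nv (nv x1 \<bullet> x2)" for x1 x2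
    by (metis s30 nv_nv rip' rip nv_mul_triple rets)
  \<comment> \<open>\<open>s212\<close> and \<open>h12\<close> give
    \<open>(d d) b = d (d b)\<close>. With \<open>nv b a = nv (d b)\<close>, the right side of
    \<open>s206\<close> collapses to \<open>d\<close>.\<close>
  have s217: "nv (a \<bullet> c \<bullet> a) \<bullet> (w \<bullet> c) = d"
    by (metis s206 rip s130 s212 nv_nv rip' h12 rets)
  \<comment> \<open>So the inner map of \<open>(a, b)\<close> also fixes
    \<open>nv c\<close>.\<close>
  have s218: "nv c \<bullet> a \<bullet> b = nv c \<bullet> (a \<bullet> b)"
    by (metis rip nv_nv s72 s215 s65 rets)
  have s219: "x1 \<bullet> x2 \<bullet> x1 \<bullet> x3 = x1 \<bullet> (x2 \<bullet> x1) \<bullet> x3 \<or> x2 \<bullet> x2 \<bullet> x1 = x2 \<bullet> (x2 \<bullet> x1)" for x1 x2 x3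
    by (metis nv_mul_triple rip s2 bol_mul s1 s10 rets)
  have s220: "nv x1 \<bullet> (x2 \<bullet> x1) \<bullet> nv (x1 \<bullet> x2 \<bullet> x1) = x2 \<bullet> nv (x1 \<bullet> x2) \<bullet> nv x1" for x1 x2
    by (metis nv_triple nv_nv bol_mul s216 rets)
  have s221: "d \<bullet> nv (w \<bullet> c) \<bullet> a = nv a \<bullet> nv c"
    by (metis s13 rip s217 rets)
  have s222: "a \<bullet> (d \<bullet> nv (w \<bullet> c)) = nv (w \<bullet> c)"
    by (metis s30 s194 rip s217 rets)
  have s223: "nv c \<bullet> (a \<bullet> b) \<bullet> x1 \<bullet> b = nv c \<bullet> a \<bullet> (b \<bullet> x1 \<bullet> b)" for x1
    by (metis bol_mul s218)
  have s224: "nv x1 \<bullet> (nv x1 \<bullet> x2) = nv (x1 \<bullet> x1) \<bullet> x2 \<or> x2 \<bullet> (x2 \<bullet> nv x1) \<bullet> x1 \<bullet> nv x2 = ret x2" for x1 x2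
    by (metis s219 s72 rip s28 rets)
  have s225: "nv a \<bullet> (nv a \<bullet> nv c) \<bullet> c = d \<bullet> nv a"
    by (metis s220 s221 s222 nv_nv rip' rip s194 rets)
  have s226: "nv c \<bullet> nv b \<bullet> (d \<bullet> b) = nv (c \<bullet> c) \<bullet> nv a"
    by (metis s223 s33 s68 h9 s198 s203 s37 s28)
  have s227: "x1 \<bullet> x2 \<bullet> x3 \<bullet> nv (x2 \<bullet> x3) \<bullet> nv x2 = x1 \<bullet> (x3 \<bullet> x2) \<bullet> nv (x2 \<bullet> x3 \<bullet> x2)" for x1 x2 x3
    by (metis bol_mul s8 nv_triple)
  have s228: "nv c \<bullet> nv b \<bullet> (d \<bullet> b) = nv c \<bullet> nv (w \<bullet> c)"
    by (metis s226 s224 s225 s194 nv_nv rip' h12 rets)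
  have s229: "nv c \<bullet> d \<bullet> (a \<bullet> b) = nv c \<bullet> b"
    by (metis s227 s228 s101 s194 nv_nv rip' rip s52 mul_nv one_mul rets)
  have s230: "nv c \<bullet> nv a = nv c \<bullet> d"
    by (metis s194 rip s229 s109 rets)
  \<comment> \<open>Cancelling \<open>nv c\<close> in \<open>s230\<close> gives
    \<open>d = nv a\<close>; then \<open>h2\<close> is the left inverse property at
    \<open>(d, b)\<close>, which \<open>h14\<close> denies.\<close>
  have s231: "nv d = a"
    by (metis rip s30 s230 s39 nv_mul_triple nv_nv rets)
  have s232: "False"
    by (metis h14 s231 h2)
  then show False .
qed

lemma lip_if_flex_or_flex_swapped:
  assumes hyp: "\<And>x y. assoc x x y \<or> assoc y y x"
  shows "assoc (nv x) x y"
proof (rule lip_if_flex_or_lip)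
  fix x y
  have "(x \<bullet> y) \<bullet> x = x \<bullet> (y \<bullet> x) \<or> (y \<bullet> x) \<bullet> y = y \<bullet> (x \<bullet> y)" for x y
    using hyp by (simp add: flex_iff)
  from flex_or_lip_if_flex_or_flex_swapped[OF this, of "ret x" "ret y"]
  show "assoc x x y \<or> assoc (nv x) x y"
    by simp
qed

section \<open>From the left inverse property to the Moufang identity\<close>

text \<open>By \<open>flex_lip\<close> all pairs are flexible, and flexibility rewrites
  \<open>(y z) y\<close> in the Bol identity as \<open>y (z y)\<close>.\<close>

lemma moufang_if_lip:
  assumes "\<And>x y. assoc (nv x) x y"
  shows "moufang_loop L"
proof -
  have "assoc y y z" for y z
    using assms flex_lip by blast
  then show ?thesis
    by unfold_locales (metis bol_mul flex_iff ret_id mul_def mul_closed)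
qed

lemma moufang_if_cond:
  assumes "(\<forall>x y. x \<bullet> y = y \<bullet> x \<or> assoc (nv x) x y) \<or>
      (\<forall>x y. x \<bullet> y = y \<bullet> x \<or> assoc x x y) \<or>
      (\<forall>x y. assoc (nv x) x y \<or> assoc (nv (x \<bullet> y)) x y) \<or>
      (\<forall>x y. assoc x x y \<or> assoc (nv (y \<bullet> x)) y x) \<or>
      (\<forall>x y. assoc (nv x) x y \<or> assoc (nv y) y x) \<or>
      (\<forall>x y. assoc x x y \<or> assoc (nv (x \<bullet> y)) x y) \<or>
      (\<forall>x y. assoc (nv x) x y \<or> assoc (nv (y \<bullet> x)) y x) \<or>
      (\<forall>x y. assoc x x y \<or> assoc (nv y) y x) \<or>
      (\<forall>x y. assoc x x y \<or> assoc (nv x) x y) \<or>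
      (\<forall>x y. assoc x x y \<or> assoc y y x)"
  shows "moufang_loop L"
proof (rule moufang_if_lip)
  have 7: "assoc x x y \<or> assoc (nv y) y x"
    if "\<And>x y. assoc (nv x) x y \<or> assoc (nv (y \<bullet> x)) y x" for x y
    using that[of "nv x" "y \<bullet> x"] lip_nv[of x "y \<bullet> x"] by (simp add: flex_lip assoc_mul2)
  \<comment> \<open>At \<open>(nv x, (x y) x)\<close> flexibility becomes the left inverse property
    at \<open>(x, y)\<close>. The products of this pair in its two orders are \<open>y x\<close> and
    \<open>x y\<close>, which transforms the other alternatives here and in \<open>4\<close> and
    \<open>6\<close>.\<close>
  have 2: "x \<bullet> y = y \<bullet> x \<or> assoc (nv x) x y"
    if "\<And>x y. x \<bullet> y = y \<bullet> x \<or> assoc x x y" for x y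
    using that[of "nv x" "(x \<bullet> y) \<bullet> x"] by (auto simp: flex_nv nv_mul_triple)
  have 4: "assoc (nv x) x y \<or> assoc (nv (x \<bullet> y)) x y"
    if "\<And>x y. assoc x x y \<or> assoc (nv (y \<bullet> x)) y x" for x y
    using that[of "nv x" "(x \<bullet> y) \<bullet> x"] by (simp add: flex_nv assoc_mul2 aaip_lip)
  have 6: "assoc (nv x) x y \<or> assoc (nv (y \<bullet> x)) y x"
    if "\<And>x y. assoc x x y \<or> assoc (nv (x \<bullet> y)) x y" for x y
    using that[of "nv x" "(x \<bullet> y) \<bullet> x"] assoc_swap[of "nv (y \<bullet> x)" "nv x" "(x \<bullet> y) \<bullet> x"]
      assoc_swap[of "nv (y \<bullet> x)" x y] by (simp add: flex_nv nv_mul_triple assoc_mul1 assoc_mul2)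
  fix x y
  show "assoc (nv x) x y"
    using assms
    by (elim disjE) (metis lip_if_comm_or_lip 2 lip_if_lip_or_aaip 4 lip_if_lip_or_lip_swapped
      lip_if_flex_or_lip_swapped 6 7 lip_if_flex_or_lip lip_if_flex_or_flex_swapped)+
qed

end

theorem theorem1p2:
  fixes L (structure)
  assumes "bol_loop L"
    and "(\<forall>x\<in>carrier L. \<forall>y\<in>carrier L. x \<otimes> y = y \<otimes> x \<or> inv x \<otimes> (x \<otimes> y) = y) \<or>
      (\<forall>x\<in>carrier L. \<forall>y\<in>carrier L. x \<otimes> y = y \<otimes> x \<or> (x \<otimes> y) \<otimes> x = x \<otimes> (y \<otimes> x)) \<or>
      (\<forall>x\<in>carrier L. \<forall>y\<in>carrier L. inv x \<otimes> (x \<otimes> y) = y \<or> inv (x \<otimes> y) = inv y \<otimes> inv x) \<or>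
      (\<forall>x\<in>carrier L. \<forall>y\<in>carrier L. (x \<otimes> y) \<otimes> x = x \<otimes> (y \<otimes> x) \<or> inv (y \<otimes> x) = inv x \<otimes> inv y) \<or>
      (\<forall>x\<in>carrier L. \<forall>y\<in>carrier L. inv x \<otimes> (x \<otimes> y) = y \<or> inv y \<otimes> (y \<otimes> x) = x) \<or>
      (\<forall>x\<in>carrier L. \<forall>y\<in>carrier L. (x \<otimes> y) \<otimes> x = x \<otimes> (y \<otimes> x) \<or> inv (x \<otimes> y) = inv y \<otimes> inv x) \<or>
      (\<forall>x\<in>carrier L. \<forall>y\<in>carrier L. inv x \<otimes> (x \<otimes> y) = y \<or> inv (y \<otimes> x) = inv x \<otimes> inv y) \<or>
      (\<forall>x\<in>carrier L. \<forall>y\<in>carrier L. (x \<otimes> y) \<otimes> x = x \<otimes> (y \<otimes> x) \<or> inv y \<otimes> (y \<otimes> x) = x) \<or>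
      (\<forall>x\<in>carrier L. \<forall>y\<in>carrier L. (x \<otimes> y) \<otimes> x = x \<otimes> (y \<otimes> x) \<or> inv x \<otimes> (x \<otimes> y) = y) \<or>
      (\<forall>x\<in>carrier L. \<forall>y\<in>carrier L. (x \<otimes> y) \<otimes> x = x \<otimes> (y \<otimes> x) \<or> (y \<otimes> x) \<otimes> y = y \<otimes> (x \<otimes> y))"
  shows "moufang_loop L"
proof -
  interpret bol_loop L
    by fact
  have ops: "x \<in> carrier L \<Longrightarrow> y \<in> carrier L \<Longrightarrow> x \<otimes> y = x \<bullet> y" "x \<in> carrier L \<Longrightarrow> inv x = nv x" for x y
    by (simp_all add: mul_def nv_def)
  \<comment> \<open>\<open>ret\<close> maps onto the carrier, so bounded quantifiers become
    unrestricted ones over retracted arguments.\<close>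
  have all: "(\<forall>x\<in>carrier L. \<forall>y\<in>carrier L. P x y) \<longleftrightarrow> (\<forall>x y. P (ret x) (ret y))" for P
    by (metis ret_closed ret_id)
  have lip: "inv (ret x) \<otimes> (ret x \<otimes> ret y) = ret y \<longleftrightarrow> assoc (nv x) x y"
    and flex: "(ret x \<otimes> ret y) \<otimes> ret x = ret x \<otimes> (ret y \<otimes> ret x) \<longleftrightarrow> assoc x x y"
    and aaip: "inv (ret x \<otimes> ret y) = inv (ret y) \<otimes> inv (ret x) \<longleftrightarrow> assoc (nv (x \<bullet> y)) x y"
    and comm: "ret x \<otimes> ret y = ret y \<otimes> ret x \<longleftrightarrow> x \<bullet> y = y \<bullet> x" for x y
    by (simp_all add: ops lip_iff flex_iff aaip_iff)
  show ?thesis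
    using assms(2) unfolding all lip flex aaip comm by (rule moufang_if_cond)
qed

end
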